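(* In the setting described in the context, let $\alpha>0$ and let $e_0,\dots,e_N$ be the attack sequence $e_t=e_{\alpha,t}=\mathcal L_{\alpha,t}\xi_t+\mathcal O_{\alpha,t}\nu_t$ minimizing $$J_\alpha=\mathbb E\Big[\sum_{t=0}^N\alpha(x_t-x^* )^TQ_t(x_t-x^* )+(\nu^e_t)^TR_t\nu^e_t\Big],$$ with $\mathcal L_{\alpha,t},\mathcal O_{\alpha,t}$ as given in the context. Let $J_{\alpha,d}$ and $J_{\alpha,c}$ be the values under this attack of $J_d=\mathbb E[\sum_{t=0}^N(\nu^e_t)^TR_t\nu^e_t]$ and $J_c=\mathbb E[\sum_{t=0}^N(x_t-x^* )^TQ_t(x_t-x^* )]$. Then $$J_{\alpha,d}=\operatorname{trace}\big(\Sigma^*_{\xi_0}\widetilde{\mathcal Q}_{\alpha,0}\big)+\sum_{t=0}^N\operatorname{trace}\Big(\Sigma_\nu\big(\mathcal K^T\widetilde{\mathcal Q}_{\alpha,t}\mathcal K+2\mathcal K^T\widetilde{\mathcal R}_{\alpha,t}+\widetilde{\mathcal S}_{\alpha,t}\big)\Big),$$ $$J_{\alpha,c}=\operatorname{trace}\big(\Sigma^*_{\xi_0}\overline{\mathcal Q}_{\alpha,0}\big)+\sum_{t=0}^N\operatorname{trace}\Big(\widehat PQ_t+\Sigma_\nu\big(\mathcal K^T\overline{\mathcal Q}_{\alpha,t}\mathcal K+2\mathcal K^T\overline{\mathcal R}_{\alpha,t}+\overline{\mathcal S}_{\alpha,t}\big)\Big),$$ where $\widetilde{\mathcal Q}_{\alpha,N+1}=\overline{\mathcal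 Q}_{\alpha,N+1}=0$ and, for $t=N,\dots,0$, $$\widetilde{\mathcal Q}_{\alpha,t}=(\mathcal A+\mathcal B\mathcal L_{\alpha,t})^T\widetilde{\mathcal Q}_{\alpha,t+1}(\mathcal A+\mathcal B\mathcal L_{\alpha,t})+(\widetilde{\mathcal C}+\Psi\mathcal L_{\alpha,t})^TR_t(\widetilde{\mathcal C}+\Psi\mathcal L_{\alpha,t}),$$ $$\overline{\mathcal Q}_{\alpha,t}=(\mathcal A+\mathcal B\mathcal L_{\alpha,t})^T\overline{\mathcal Q}_{\alpha,t+1}(\mathcal A+\mathcal B\mathcal L_{\alpha,t})+\mathcal H^TQ_t\mathcal H,$$ $$\widetilde{\mathcal R}_{\alpha,t}=(\mathcal A+\mathcal B\mathcal L_{\alpha,t})^T\widetilde{\mathcal Q}_{\alpha,t+1}\mathcal B\mathcal O_{\alpha,t}+(\widetilde{\mathcal C}+\Psi\mathcal L_{\alpha,t})^TR_t(I_p+\Psi\mathcal O_{\alpha,t}),$$ $$\widetilde{\mathcal S}_{\alpha,t}=\mathcal O_{\alpha,t}^T\mathcal B^T\widetilde{\mathcal Q}_{\alpha,t+1}\mathcal B\mathcal O_{\alpha,t}+(I_p+\Psi\mathcal O_{\alpha,t})^TR_t(I_p+\Psi\mathcal O_{\alpha,t}),$$ $$\overline{\mathcal R}_{\alpha,t}=(\mathcal A+\mathcal B\mathcal L_{\alpha,t})^T\overline{\mathcal Q}_{\alpha,t+1}\mathcal B\mathcal O_{\alpha,t},\qquad \overline{\mathcal S}_{\alpha,t}=\mathcal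 O_{\alpha,t}^T\mathcal B^T\overline{\mathcal Q}_{\alpha,t+1}\mathcal B\mathcal O_{\alpha,t}.$$
   Context: Notation: $M^\dagger$ is the Moore-Penrose pseudoinverse; $S\succ0$ means symmetric positive definite. System. $x_{t+1}=Ax_t+Bu_t+\Gamma e_t+w_t$, $y_t=Cx_t+\Psi e_t+v_t$, with $x_t\in\mathbb{R}^n$, $u_t\in\mathbb{R}^m$, attack $e_t\in\mathbb{R}^s$, $y_t\in\mathbb{R}^p$. The noises $w_t$ are i.i.d. $\mathcal N(0,\Sigma_w)$, $v_t$ are i.i.d. $\mathcal N(0,\Sigma_v)$, $\Sigma_w,\Sigma_v\succ0$, mutually independent and independent of the Gaussian initial state. $(A,C)$ is observable, $(A,B)$ controllable, $\begin{bmatrix}\Gamma\\ \Psi\end{bmatrix}$ is injective, and $L$ is such that $A+BL$ is stable (Schur). The system has been running since $t=-\infty$, with $e_t=0$ for $t<0$, so its Kalman filter is in steady state: $P=APA^T+\Sigma_w-APC^T(CPC^T+\Sigma_v)^{-1}CPA^T$, $\Sigma_\nu=CPC^T+\Sigma_v$, $K=PC^T\Sigma_\nu^{-1}$, $\widehat P=P-PC^T\Sigma_\nu^{-1}CP$. At time $0$, $\widehat x_{0|-1}$ denotes the conditional mean of $x_0$ given the pre-attack outputs $(y_s)_{s<0}$; $x_0-\widehat x_{0|-1}\sim\mathcal N(0,P)$ is independent of the pre-attack outputs; $\widehat x_{0|-1}\sim\mathcal N(0,\Sigma_0)$, where $\Sigma_0$ is the unique solution of $\Sigma_0=(A+BL)(\Sigma_0+K\Sigma_\nu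 K^T)(A+BL)^T$; $(w_t,v_t)_{t\ge0}$ are independent of all of these. System's filter and controller (which ignore the attack), for $t=0,\dots,N$: $\widehat x^e_{0|-1}=\widehat x_{0|-1}$, $\nu_t^e=y_t-C\widehat x^e_{t|t-1}$, $\widehat x^e_t=\widehat x^e_{t|t-1}+K\nu^e_t$, $u_t=L\widehat x^e_t$, $\widehat x^e_{t+1|t}=(A+BL)\widehat x^e_t$. The superscript $0$ (e.g. $\widehat x_t^0$) denotes the same quantities on the same noise and initial-state realization when $e_0=e_1=\dots=0$. Attacker. Let $\widetilde y_t=Cx_t+v_t$. The attacker's Kalman filter is $\nu_t=\widetilde y_t-C\widehat x_{t|t-1}$, $\widehat x_t=\widehat x_{t|t-1}+K\nu_t$, $\widehat x_{t+1|t}=A\widehat x_t+Bu_t+\Gamma e_t$. $N\ge 0$ and the target state $x^*\in\mathbb R^n$ are fixed. (Attack sequences are causal: $e_t$ is a function of the pre-attack outputs and of $\mathcal I_t$, where $\mathcal I_0=\{\widetilde y_0\}$, $\mathcal I_{t+1}=\{\mathcal I_t,\widetilde y_{t+1},e_t\}$.) Attack-effect state. $\theta_t\in\mathbb R^{3n}$: $\theta_0=0$, $\theta_{t+1}=\widehat{\mathcal A}\theta_t+\widehat{\mathcal B}e_t$, with $$\widehat{\mathcal A}=\begin{bmatrix}(I_n-KC)A+BL & KC & KC \\ A B L & A & 0 \\ 0 & 0 & A\end{bmatrix},\ \widehat{\mathcal B}=\begin{bmatrix}K\Psi \\ 0 \\ \Gamma\end{bmatrix},\ \widehat{\mathcal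 C}=\begin{bmatrix}-CA & C & C\end{bmatrix}.$$ Augmented quantities. $\xi_t=(\widehat x_t;\theta_t;\widehat x^0_t;x^* )\in\mathbb R^{6n}$ (stacked column), $\Omega=\begin{bmatrix}(I_n-KC)A+BL & KC & KC\end{bmatrix}$, $$\mathcal A=\begin{bmatrix}A & BL\Omega & BL & 0 \\ 0 & \widehat{\mathcal A} & 0 & 0 \\ 0 & 0 & A+BL & 0 \\ 0 & 0 & 0 & I_n\end{bmatrix},\ \mathcal B=\begin{bmatrix}\Gamma+BLK\Psi \\ \widehat{\mathcal B} \\ 0 \\ 0\end{bmatrix},\ \mathcal K=\begin{bmatrix}K \\ 0 \\ K \\ 0\end{bmatrix},$$ $$\mathcal H=\begin{bmatrix}I_n & 0 & 0 & -I_n\end{bmatrix},\ \widetilde{\mathcal C}=\begin{bmatrix}0 & \widehat{\mathcal C} & 0 & 0\end{bmatrix},\ \mathcal C=\begin{bmatrix}\mathcal H \\ \widetilde{\mathcal C}\end{bmatrix},\ \mathcal D=\begin{bmatrix}0 \\ \Psi\end{bmatrix},\ \mathcal M=\begin{bmatrix}0 \\ I_p\end{bmatrix}.$$ $Q_t\in\mathbb R^{n\times n}$ and $R_t\in\mathbb R^{p\times p}$ are symmetric positive definite for $t=0,\dots,N$. Gains. Put $\mathcal F_{\alpha,t}=\begin{bmatrix}\alpha Q_t & 0 \\ 0 & R_t\end{bmatrix}$, $\mathcal Q_N=\mathcal C^T\mathcal F_{\alpha,N}\mathcal C-\mathcal C^T\mathcal F_{\alpha,N}\mathcal D(\mathcal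 D^T\mathcal F_{\alpha,N}\mathcal D)^\dagger\mathcal D^T\mathcal F_{\alpha,N}\mathcal C$ and, for $t<N$, with $\mathcal G_t=\mathcal D^T\mathcal F_{\alpha,t}\mathcal D+\mathcal B^T\mathcal Q_{t+1}\mathcal B$ and $\mathcal E_t=\mathcal D^T\mathcal F_{\alpha,t}\mathcal C+\mathcal B^T\mathcal Q_{t+1}\mathcal A$, $\mathcal Q_t=\mathcal C^T\mathcal F_{\alpha,t}\mathcal C+\mathcal A^T\mathcal Q_{t+1}\mathcal A-\mathcal E_t^T\mathcal G_t^{-1}\mathcal E_t$. Then $\mathcal L_{\alpha,t}=-\mathcal G_t^{-1}\mathcal E_t$, $\mathcal O_{\alpha,t}=-\mathcal G_t^{-1}\mathcal D^T\mathcal F_{\alpha,t}\mathcal M$ for $t<N$, and $\mathcal L_{\alpha,N}=-(\mathcal D^T\mathcal F_{\alpha,N}\mathcal D)^\dagger\mathcal D^T\mathcal F_{\alpha,N}\mathcal C$, $\mathcal O_{\alpha,N}=-(\mathcal D^T\mathcal F_{\alpha,N}\mathcal D)^\dagger\mathcal D^T\mathcal F_{\alpha,N}\mathcal M$. Initial statistics. $\Sigma^*_{\xi_0}=\begin{bmatrix}I_n & 0 & I_n & 0\end{bmatrix}^T\Sigma_0\begin{bmatrix}I_n & 0 & I_n & 0\end{bmatrix}+\xi^*(\xi^* )^T$, where $\xi^*=(0;0;0;x^* )\in\mathbb R^{6n}$ and the zero blocks match the block sizes $n,3n,n,n$. *)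

theory Defs
  imports "HOL-Probability.Probability"
begin

section \<open>Block matrices and matrix preliminaries\<close>

text \<open>
  Horizontal and vertical concatenation, indexed by sum types. The vertical one also stacks
  vectors. Both associate to the right, so that for instance
  \<open>X ||| Y ||| Z /// X' ||| Y' ||| Z'\<close> is a matrix with two block rows and three block columns.
\<close>

definition hcat :: "'x^'a^'r \<Rightarrow> 'x^'b^'r \<Rightarrow> 'x^('a::finite + 'b::finite)^'r" (infixr "|||" 62) where
  "X ||| Y = (\<chi> i j. case j of Inl a \<Rightarrow> X $ i $ a | Inr b \<Rightarrow> Y $ i $ b)"

definition vcat :: "'x^'a \<Rightarrow> 'x^'b \<Rightarrow> 'x^('a::finite + 'b::finite)" (infixr "'/'/'/" 61) where
  "X /// Y = (\<chi> i. case i of Inl a \<Rightarrow> X $ a | Inr b \<Rightarrow> Y $ b)"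

lemma hcat_mult_vcat: "(X ||| Y) *v (a /// b) = X *v a + Y *v b"
  by (simp add: vec_eq_iff matrix_vector_mult_def hcat_def vcat_def UNIV_Plus_UNIV[symmetric] sum.Plus
      del: UNIV_Plus_UNIV)

lemma vcat_mult_vec: "(X /// Y) *v a = (X *v a) /// (Y *v a)"
  by (simp add: vec_eq_iff matrix_vector_mult_def vcat_def split: sum.split)

type_synonym 'n blk3 = "'n + 'n + 'n"
type_synonym 'n blk6 = "'n + 'n blk3 + 'n + 'n"

definition sym_psd :: "real^'n^'n \<Rightarrow> bool" where
  "sym_psd X \<longleftrightarrow> transpose X = X \<and> (\<forall>z. 0 \<le> z \<bullet> (X *v z))"

definition sym_pd :: "real^'n^'n \<Rightarrow> bool" where
  "sym_pd X \<longleftrightarrow> transpose X = X \<and> (\<forall>z. z \<noteq> 0 \<longrightarrow> 0 < z \<bullet> (X *v z))"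

text \<open>Moore--Penrose pseudoinverse: the unique solution of the four Penrose equations.\<close>

definition pinv :: "real^'n^'m \<Rightarrow> real^'m^'n" where
  "pinv X = (THE Y. X ** Y ** X = X \<and> Y ** X ** Y = Y \<and>
     transpose (X ** Y) = X ** Y \<and> transpose (Y ** X) = Y ** X)"

definition schur_stable :: "real^'n^'n \<Rightarrow> bool" where
  "schur_stable X \<longleftrightarrow>
     (\<forall>(c::complex) (z::complex^'n). z \<noteq> 0 \<longrightarrow> map_matrix complex_of_real X *v z = c *s z \<longrightarrow> cmod c < 1)"

definition observable :: "real^'n^'n \<Rightarrow> real^'n^'p \<Rightarrow> bool" where
  "observable A C \<longleftrightarrow> (\<forall>z. (\<forall>k. C *v (((*v) A ^^ k) z) = 0) \<longrightarrow> z = 0)"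

text \<open>Every state is reachable from the origin in finitely many steps.\<close>

definition controllable :: "real^'n^'n \<Rightarrow> real^'m^'n \<Rightarrow> bool" where
  "controllable A B \<longleftrightarrow> (\<forall>z. \<exists>k u. z = (\<Sum>i<k. ((*v) A ^^ i) (B *v u i)))"


section \<open>Gaussian vectors, independence, conditional mean\<close>

text \<open>
  \<open>X\<close> has law \<open>N(\<mu>, \<Sigma>)\<close>: every linear functional of \<open>X\<close> is univariate normal. A zero variance
  is treated separately, so that \<open>\<Sigma>\<close> may be singular.
\<close>

definition gaussian_vector ::
  "'w measure \<Rightarrow> real^'n \<Rightarrow> real^'n^'n \<Rightarrow> ('w \<Rightarrow> real^'n) \<Rightarrow> bool" where
  "gaussian_vector M \<mu> \<Sigma> X \<longleftrightarrow> X \<in> borel_measurable M \<and> sym_psd \<Sigma> \<and>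
     (\<forall>c. if c \<bullet> (\<Sigma> *v c) = 0 then (AE \<omega> in M. c \<bullet> X \<omega> = c \<bullet> \<mu>)
          else distributed M lborel (\<lambda>\<omega>. c \<bullet> X \<omega>)
                 (\<lambda>r. ennreal (normal_density (c \<bullet> \<mu>) (sqrt (c \<bullet> (\<Sigma> *v c))) r)))"

text \<open>
  Independence of two random elements with values in possibly different types (the library's
  \<open>indep_var\<close> needs a common value type).
\<close>

definition indep_rv ::
  "'w measure \<Rightarrow> 'b measure \<Rightarrow> ('w \<Rightarrow> 'b) \<Rightarrow> 'c measure \<Rightarrow> ('w \<Rightarrow> 'c) \<Rightarrow> bool" where
  "indep_rv M N X N' Y \<longleftrightarrow> X \<in> measurable M N \<and> Y \<in> measurable M N' \<and>
     prob_space.indep_set M (sets (vimage_algebra (space M) X N)) (sets (vimage_algebra (space M) Y N'))"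

text \<open>\<open>Z\<close> is a version of the componentwise conditional expectation of \<open>X\<close> given \<open>Y\<close>.\<close>

definition cond_mean ::
  "'w measure \<Rightarrow> 'b measure \<Rightarrow> ('w \<Rightarrow> 'b) \<Rightarrow> ('w \<Rightarrow> real^'n) \<Rightarrow> ('w \<Rightarrow> real^'n) \<Rightarrow> bool" where
  "cond_mean M N Y X Z \<longleftrightarrow>
     Z \<in> borel_measurable (vimage_algebra (space M) Y N) \<and>
     (\<forall>i. AE \<omega> in M. Z \<omega> $ i =
        real_cond_exp M (vimage_algebra (space M) Y N) (\<lambda>\<omega>. X \<omega> $ i) \<omega>)"


section \<open>System data\<close>

record ('n::finite, 'm::finite, 's::finite, 'p::finite) plant =
  matA :: "real^'n^'n"
  matB :: "real^'m^'n"
  matC :: "real^'n^'p"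
  mat\<Gamma> :: "real^'s^'n"
  mat\<Psi> :: "real^'s^'p"
  matL :: "real^'n^'m"
  \<Sigma>w :: "real^'n^'n"
  \<Sigma>v :: "real^'p^'p"
  matP :: "real^'n^'n"       \<comment> \<open>steady-state prediction error covariance\<close>
  \<Sigma>0 :: "real^'n^'n"         \<comment> \<open>covariance of the one-step prediction at time 0\<close>
  horizon :: nat
  target :: "real^'n"
  matQ :: "nat \<Rightarrow> real^'n^'n"
  matR :: "nat \<Rightarrow> real^'p^'p"

definition \<Sigma>\<nu> :: "('n::finite,'m::finite,'s::finite,'p::finite) plant \<Rightarrow> real^'p^'p" where
  "\<Sigma>\<nu> S = matC S ** matP S ** transpose (matC S) + \<Sigma>v S"

definition matK :: "('n::finite,'m::finite,'s::finite,'p::finite) plant \<Rightarrow> real^'p^'n" where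
  "matK S = matP S ** transpose (matC S) ** matrix_inv (\<Sigma>\<nu> S)"

definition Phat :: "('n::finite,'m::finite,'s::finite,'p::finite) plant \<Rightarrow> real^'n^'n" where
  "Phat S = matP S - matP S ** transpose (matC S) ** matrix_inv (\<Sigma>\<nu> S) ** matC S ** matP S"

definition matABL :: "('n::finite,'m::finite,'s::finite,'p::finite) plant \<Rightarrow> real^'n^'n" where
  "matABL S = matA S + matB S ** matL S"

definition valid_plant :: "('n::finite,'m::finite,'s::finite,'p::finite) plant \<Rightarrow> bool" where
  "valid_plant S \<longleftrightarrow>
     sym_pd (\<Sigma>w S) \<and> sym_pd (\<Sigma>v S) \<and>
     observable (matA S) (matC S) \<and> controllable (matA S) (matB S) \<and>
     inj (\<lambda>a. (mat\<Gamma> S /// mat\<Psi> S) *v a) \<and> schur_stable (matABL S) \<and>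
     sym_psd (matP S) \<and>
     matP S = matA S ** matP S ** transpose (matA S) + \<Sigma>w S
       - matA S ** matP S ** transpose (matC S)
         ** matrix_inv (matC S ** matP S ** transpose (matC S) + \<Sigma>v S)
         ** matC S ** matP S ** transpose (matA S) \<and>
     (\<forall>X. X = matABL S ** (X + matK S ** \<Sigma>\<nu> S ** transpose (matK S)) ** transpose (matABL S)
        \<longleftrightarrow> X = \<Sigma>0 S) \<and>
     (\<forall>t\<le>horizon S. sym_pd (matQ S t) \<and> sym_pd (matR S t))"

text \<open>
  The random ingredients. The noises are indexed by all integers. The \<open>pre\<close> processes describe
  the attack-free run up to time 0: only the states \<open>preX s\<close> and predictions \<open>prePred s\<close> (of the
  state at \<open>s\<close> from the outputs before \<open>s\<close>) with \<open>s \<le> 0\<close>, and the outputs \<open>preY s\<close> with \<open>s < 0\<close>,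
  are used. The run under attack starts from \<open>preX 0\<close> and \<open>prePred 0\<close>.
\<close>

record ('w, 'n::finite, 'p::finite) scenario =
  noiseW :: "int \<Rightarrow> 'w \<Rightarrow> real^'n"
  noiseV :: "int \<Rightarrow> 'w \<Rightarrow> real^'p"
  preX :: "int \<Rightarrow> 'w \<Rightarrow> real^'n"
  preY :: "int \<Rightarrow> 'w \<Rightarrow> real^'p"
  prePred :: "int \<Rightarrow> 'w \<Rightarrow> real^'n"

abbreviation borel_fam :: "'i set \<Rightarrow> ('i \<Rightarrow> 'b::topological_space) measure" where
  "borel_fam I \<equiv> PiM I (\<lambda>_. borel)"

definition pre_outputs :: "('w,'n::finite,'p::finite) scenario \<Rightarrow> 'w \<Rightarrow> int \<Rightarrow> real^'p" where
  "pre_outputs D \<omega> = (\<lambda>s\<in>{..<0}. preY D s \<omega>)"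

definition future_noise :: "('w,'n::finite,'p::finite) scenario \<Rightarrow> 'w \<Rightarrow> int \<Rightarrow> (real^'n) \<times> (real^'p)" where
  "future_noise D \<omega> = (\<lambda>t\<in>{0..}. (noiseW D t \<omega>, noiseV D t \<omega>))"

text \<open>
  In \<open>pairs_indep\<close> and \<open>wv_indep\<close>: the pairs \<open>(w t, v t)\<close> are independent over \<open>t\<close> and the two
  components of each pair are independent, i.e. all the noise vectors are mutually independent.
\<close>

locale attack_setting = prob_space M
  for M :: "'w measure" +
  fixes S :: "('n::finite,'m::finite,'s::finite,'p::finite) plant"
    and D :: "('w,'n,'p) scenario"
  assumes valid: "valid_plant S"
    and w_gauss: "\<And>t. gaussian_vector M 0 (\<Sigma>w S) (noiseW D t)"
    and v_gauss: "\<And>t. gaussian_vector M 0 (\<Sigma>v S) (noiseV D t)"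
    and pairs_indep: "indep_vars (\<lambda>_. borel) (\<lambda>t \<omega>. (noiseW D t \<omega>, noiseV D t \<omega>)) (UNIV :: int set)"
    and wv_indep: "\<And>t. indep_rv M borel (noiseW D t) borel (noiseV D t)"
    and pre_meas: "\<And>s. s \<le> 0 \<Longrightarrow> preX D s \<in> borel_measurable M"
      "\<And>s. s \<le> 0 \<Longrightarrow> prePred D s \<in> borel_measurable M"
      "\<And>s. s < 0 \<Longrightarrow> preY D s \<in> borel_measurable M"
    and pre_state: "\<And>s \<omega>. s < 0 \<Longrightarrow> \<omega> \<in> space M \<Longrightarrow> preX D (s + 1) \<omega> =
        matA S *v preX D s \<omega>
        + matB S *v (matL S *v (prePred D s \<omega> + matK S *v (preY D s \<omega> - matC S *v prePred D s \<omega>)))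
        + noiseW D s \<omega>"
    and pre_output: "\<And>s \<omega>. s < 0 \<Longrightarrow> \<omega> \<in> space M \<Longrightarrow>
        preY D s \<omega> = matC S *v preX D s \<omega> + noiseV D s \<omega>"
    and pre_filter: "\<And>s \<omega>. s < 0 \<Longrightarrow> \<omega> \<in> space M \<Longrightarrow> prePred D (s + 1) \<omega> =
        matABL S *v (prePred D s \<omega> + matK S *v (preY D s \<omega> - matC S *v prePred D s \<omega>))"
    and pred0_cond_mean: "cond_mean M (borel_fam {..<0}) (pre_outputs D) (preX D 0) (prePred D 0)"
    and pred0_gauss: "gaussian_vector M 0 (\<Sigma>0 S) (prePred D 0)"
    and err0_gauss: "gaussian_vector M 0 (matP S) (\<lambda>\<omega>. preX D 0 \<omega> - prePred D 0 \<omega>)"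
    and err0_indep: "indep_rv M borel (\<lambda>\<omega>. preX D 0 \<omega> - prePred D 0 \<omega>)
        (borel_fam {..<0}) (pre_outputs D)"
    and future_indep: "indep_rv M (borel_fam {0..}) (future_noise D)
        (borel \<Otimes>\<^sub>M borel_fam {..<0}) (\<lambda>\<omega>. (preX D 0 \<omega>, pre_outputs D \<omega>))"


section \<open>The run under an attack\<close>

text \<open>
  An attack is a process \<open>a\<close>, where \<open>a t \<omega>\<close> is the attack vector at time \<open>t\<close>. The following
  recursion produces the state together with the system's (attack-ignorant) one-step prediction
  of it; the lemmas \<open>plant_state_Suc\<close> and \<open>sys_pred_Suc\<close> below restate it
  in terms of outputs, estimates and inputs.
\<close>

type_synonym ('w, 's) attack = "nat \<Rightarrow> 'w \<Rightarrow> real^'s"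

fun closed_loop ::
  "('n::finite,'m::finite,'s::finite,'p::finite) plant \<Rightarrow> ('w,'n,'p) scenario \<Rightarrow> ('w,'s) attack
    \<Rightarrow> nat \<Rightarrow> 'w \<Rightarrow> (real^'n) \<times> (real^'n)" where
  "closed_loop S D a 0 \<omega> = (preX D 0 \<omega>, prePred D 0 \<omega>)"
| "closed_loop S D a (Suc t) \<omega> =
     (let (x, z) = closed_loop S D a t \<omega>;
          y = matC S *v x + mat\<Psi> S *v a t \<omega> + noiseV D (int t) \<omega>;
          xh = z + matK S *v (y - matC S *v z)
      in (matA S *v x + matB S *v (matL S *v xh) + mat\<Gamma> S *v a t \<omega> + noiseW D (int t) \<omega>,
          matABL S *v xh))"

definition plant_state where
  "plant_state S D a t \<omega> = fst (closed_loop S D a t \<omega>)"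

definition sys_out where
  "sys_out S D a t \<omega> = matC S *v plant_state S D a t \<omega> + mat\<Psi> S *v a t \<omega> + noiseV D (int t) \<omega>"

definition sys_pred where
  "sys_pred S D a t \<omega> = snd (closed_loop S D a t \<omega>)"

definition sys_innov where
  "sys_innov S D a t \<omega> = sys_out S D a t \<omega> - matC S *v sys_pred S D a t \<omega>"

definition sys_est where
  "sys_est S D a t \<omega> = sys_pred S D a t \<omega> + matK S *v sys_innov S D a t \<omega>"

definition sys_in where
  "sys_in S D a t \<omega> = matL S *v sys_est S D a t \<omega>"

lemma closed_loop_0:
  "plant_state S D a 0 \<omega> = preX D 0 \<omega>" "sys_pred S D a 0 \<omega> = prePred D 0 \<omega>"
  by (simp_all add: plant_state_def sys_pred_def)

lemma plant_state_Suc: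
  "plant_state S D a (Suc t) \<omega> = matA S *v plant_state S D a t \<omega> + matB S *v sys_in S D a t \<omega>
     + mat\<Gamma> S *v a t \<omega> + noiseW D (int t) \<omega>"
  by (simp add: plant_state_def sys_in_def sys_est_def sys_innov_def sys_out_def sys_pred_def
      case_prod_unfold Let_def)

lemma sys_pred_Suc: "sys_pred S D a (Suc t) \<omega> = matABL S *v sys_est S D a t \<omega>"
  by (simp add: plant_state_def sys_est_def sys_innov_def sys_out_def sys_pred_def
      case_prod_unfold Let_def)

text \<open>The attacker's measurement, Kalman filter and attack-effect state.\<close>

definition att_output where
  "att_output S D a t \<omega> = matC S *v plant_state S D a t \<omega> + noiseV D (int t) \<omega>"

fun att_pred ::
  "('n::finite,'m::finite,'s::finite,'p::finite) plant \<Rightarrow> ('w,'n,'p) scenario \<Rightarrow> ('w,'s) attack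
    \<Rightarrow> nat \<Rightarrow> 'w \<Rightarrow> real^'n" where
  "att_pred S D a 0 \<omega> = prePred D 0 \<omega>"
| "att_pred S D a (Suc t) \<omega> =
     matA S *v (att_pred S D a t \<omega>
       + matK S *v (att_output S D a t \<omega> - matC S *v att_pred S D a t \<omega>))
     + matB S *v sys_in S D a t \<omega> + mat\<Gamma> S *v a t \<omega>"

definition att_innov where
  "att_innov S D a t \<omega> = att_output S D a t \<omega> - matC S *v att_pred S D a t \<omega>"

definition att_est where
  "att_est S D a t \<omega> = att_pred S D a t \<omega> + matK S *v att_innov S D a t \<omega>"

definition \<Omega>row :: "('n::finite,'m::finite,'s::finite,'p::finite) plant \<Rightarrow> real^'n blk3^'n" where
  "\<Omega>row S = ((mat 1 - matK S ** matC S) ** matA S + matB S ** matL S)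
     ||| matK S ** matC S ||| matK S ** matC S"

definition Ahat :: "('n::finite,'m::finite,'s::finite,'p::finite) plant \<Rightarrow> real^'n blk3^'n blk3" where
  "Ahat S =
     ((mat 1 - matK S ** matC S) ** matA S + matB S ** matL S
                                  ||| matK S ** matC S ||| matK S ** matC S)
     /// (matA S ** matB S ** matL S ||| matA S ||| 0)
     /// (0 ||| 0 ||| matA S)"

definition Bhat :: "('n::finite,'m::finite,'s::finite,'p::finite) plant \<Rightarrow> real^'s^'n blk3" where
  "Bhat S = matK S ** mat\<Psi> S /// 0 /// mat\<Gamma> S"

definition Chat :: "('n::finite,'m::finite,'s::finite,'p::finite) plant \<Rightarrow> real^'n blk3^'p" where
  "Chat S = - (matC S ** matA S) ||| matC S ||| matC S"

fun effect_state ::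
  "('n::finite,'m::finite,'s::finite,'p::finite) plant \<Rightarrow> ('w,'s) attack \<Rightarrow> nat \<Rightarrow> 'w \<Rightarrow> real^'n blk3" where
  "effect_state S a 0 \<omega> = 0"
| "effect_state S a (Suc t) \<omega> = Ahat S *v effect_state S a t \<omega> + Bhat S *v a t \<omega>"

definition aug_state ::
  "('n::finite,'m::finite,'s::finite,'p::finite) plant \<Rightarrow> ('w,'n,'p) scenario \<Rightarrow> ('w,'s) attack
    \<Rightarrow> nat \<Rightarrow> 'w \<Rightarrow> real^'n blk6" where
  "aug_state S D a t \<omega> =
     att_est S D a t \<omega> /// effect_state S a t \<omega> /// sys_est S D (\<lambda>_ _. 0) t \<omega> /// target S"


section \<open>Augmented matrices and gains\<close>

definition cA :: "('n::finite,'m::finite,'s::finite,'p::finite) plant \<Rightarrow> real^'n blk6^'n blk6" where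
  "cA S = (matA S ||| matB S ** matL S ** \<Omega>row S ||| matB S ** matL S ||| 0)
      /// (0 ||| Ahat S ||| 0 ||| 0)
      /// (0 ||| 0 ||| matA S + matB S ** matL S ||| 0)
      /// (0 ||| 0 ||| 0 ||| mat 1)"

definition cB :: "('n::finite,'m::finite,'s::finite,'p::finite) plant \<Rightarrow> real^'s^'n blk6" where
  "cB S = mat\<Gamma> S + matB S ** matL S ** matK S ** mat\<Psi> S /// Bhat S /// 0 /// 0"

definition cK :: "('n::finite,'m::finite,'s::finite,'p::finite) plant \<Rightarrow> real^'p^'n blk6" where
  "cK S = matK S /// 0 /// matK S /// 0"

definition cH :: "('n::finite,'m::finite,'s::finite,'p::finite) plant \<Rightarrow> real^'n blk6^'n" where
  "cH S = mat 1 ||| 0 ||| 0 ||| - mat 1"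

definition Ctil :: "('n::finite,'m::finite,'s::finite,'p::finite) plant \<Rightarrow> real^'n blk6^'p" where
  "Ctil S = 0 ||| Chat S ||| 0 ||| 0"

definition cC :: "('n::finite,'m::finite,'s::finite,'p::finite) plant \<Rightarrow> real^'n blk6^('n + 'p)" where
  "cC S = cH S /// Ctil S"

definition cD :: "('n::finite,'m::finite,'s::finite,'p::finite) plant \<Rightarrow> real^'s^('n + 'p)" where
  "cD S = 0 /// mat\<Psi> S"

definition cM :: "('n::finite,'m::finite,'s::finite,'p::finite) plant \<Rightarrow> real^'p^('n + 'p)" where
  "cM S = 0 /// mat 1"

definition cF :: "('n::finite,'m::finite,'s::finite,'p::finite) plant \<Rightarrow> real \<Rightarrow> nat \<Rightarrow> real^('n + 'p)^('n + 'p)" where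
  "cF S \<alpha> t = (\<alpha> *\<^sub>R matQ S t ||| 0) /// (0 ||| matR S t)"

text \<open>
  \<open>cG_of\<close> and \<open>cE_of\<close> take the Riccati matrix of time \<open>t + 1\<close> as an argument;
  in \<open>cG\<close> and \<open>cE\<close> it is supplied.
\<close>

definition cG_of :: "('n::finite,'m::finite,'s::finite,'p::finite) plant \<Rightarrow> real \<Rightarrow> nat
    \<Rightarrow> real^'n blk6^'n blk6 \<Rightarrow> real^'s^'s" where
  "cG_of S \<alpha> t X = transpose (cD S) ** cF S \<alpha> t ** cD S + transpose (cB S) ** X ** cB S"

definition cE_of :: "('n::finite,'m::finite,'s::finite,'p::finite) plant \<Rightarrow> real \<Rightarrow> nat
    \<Rightarrow> real^'n blk6^'n blk6 \<Rightarrow> real^'n blk6^'s" where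
  "cE_of S \<alpha> t X = transpose (cD S) ** cF S \<alpha> t ** cC S + transpose (cB S) ** X ** cA S"

text \<open>Only \<open>t \<le> horizon S\<close> matters; later values are junk equal to the terminal one.\<close>

function cQ :: "('n::finite,'m::finite,'s::finite,'p::finite) plant \<Rightarrow> real \<Rightarrow> nat \<Rightarrow> real^'n blk6^'n blk6" where
  "cQ S \<alpha> t =
     (if t < horizon S then
        transpose (cC S) ** cF S \<alpha> t ** cC S + transpose (cA S) ** cQ S \<alpha> (Suc t) ** cA S
        - transpose (cE_of S \<alpha> t (cQ S \<alpha> (Suc t)))
          ** matrix_inv (cG_of S \<alpha> t (cQ S \<alpha> (Suc t)))
          ** cE_of S \<alpha> t (cQ S \<alpha> (Suc t))
      else
        transpose (cC S) ** cF S \<alpha> (horizon S) ** cC S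
        - transpose (cC S) ** cF S \<alpha> (horizon S) ** cD S
          ** pinv (transpose (cD S) ** cF S \<alpha> (horizon S) ** cD S)
          ** transpose (cD S) ** cF S \<alpha> (horizon S) ** cC S)"
  by pat_completeness auto
termination by (relation "Wellfounded.measure (\<lambda>(S, \<alpha>, t). horizon S - t)") auto

declare cQ.simps [simp del]

definition cG where "cG S \<alpha> t = cG_of S \<alpha> t (cQ S \<alpha> (Suc t))"
definition cE where "cE S \<alpha> t = cE_of S \<alpha> t (cQ S \<alpha> (Suc t))"

definition cL :: "('n::finite,'m::finite,'s::finite,'p::finite) plant \<Rightarrow> real \<Rightarrow> nat \<Rightarrow> real^'n blk6^'s" where
  "cL S \<alpha> t =
     (if t < horizon S then - (matrix_inv (cG S \<alpha> t) ** cE S \<alpha> t)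
      else - (pinv (transpose (cD S) ** cF S \<alpha> (horizon S) ** cD S)
              ** transpose (cD S) ** cF S \<alpha> (horizon S) ** cC S))"

definition cO :: "('n::finite,'m::finite,'s::finite,'p::finite) plant \<Rightarrow> real \<Rightarrow> nat \<Rightarrow> real^'p^'s" where
  "cO S \<alpha> t =
     (if t < horizon S then - (matrix_inv (cG S \<alpha> t) ** transpose (cD S) ** cF S \<alpha> t ** cM S)
      else - (pinv (transpose (cD S) ** cF S \<alpha> (horizon S) ** cD S)
              ** transpose (cD S) ** cF S \<alpha> (horizon S) ** cM S))"


section \<open>Costs and optimality\<close>

definition detect_cost where
  "detect_cost S D a \<omega> =
     (\<Sum>t\<le>horizon S. sys_innov S D a t \<omega> \<bullet> (matR S t *v sys_innov S D a t \<omega>))"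

definition control_cost where
  "control_cost S D a \<omega> =
     (\<Sum>t\<le>horizon S. (plant_state S D a t \<omega> - target S)
        \<bullet> (matQ S t *v (plant_state S D a t \<omega> - target S)))"

definition J_d where
  "J_d M S D a = (\<integral>\<omega>. detect_cost S D a \<omega> \<partial>M)"

definition J_c where
  "J_c M S D a = (\<integral>\<omega>. control_cost S D a \<omega> \<partial>M)"

text \<open>
  The joint cost is extended-valued: the integrand is nonnegative, and a competing attack of
  infinite cost must not be given the value 0 of a non-integrable Bochner integral.
\<close>

definition J_joint :: "'w measure \<Rightarrow> ('n::finite,'m::finite,'s::finite,'p::finite) plant
    \<Rightarrow> ('w,'n,'p) scenario \<Rightarrow> real \<Rightarrow> ('w,'s) attack \<Rightarrow> ennreal" where
  "J_joint M S D \<alpha> a = (\<integral>\<^sup>+\<omega>. ennreal (\<Sum>t\<le>horizon S.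
      \<alpha> * ((plant_state S D a t \<omega> - target S) \<bullet> (matQ S t *v (plant_state S D a t \<omega> - target S)))
      + sys_innov S D a t \<omega> \<bullet> (matR S t *v sys_innov S D a t \<omega>)) \<partial>M)"

text \<open>
  The attack at time \<open>t\<close> is a Borel function of the pre-attack outputs, the attacker's
  measurements up to time \<open>t\<close>, and the attacks before \<open>t\<close>.
\<close>

definition causal_attack :: "'w measure \<Rightarrow> ('n::finite,'m::finite,'s::finite,'p::finite) plant
    \<Rightarrow> ('w,'n,'p) scenario \<Rightarrow> ('w,'s) attack \<Rightarrow> bool" where
  "causal_attack M S D a \<longleftrightarrow> (\<forall>t\<le>horizon S.
     \<exists>f \<in> borel_measurable (borel_fam {..<0::int} \<Otimes>\<^sub>M (borel_fam {..t} \<Otimes>\<^sub>M borel_fam {..<t})).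
       \<forall>\<omega>\<in>space M. a t \<omega> =
         f (pre_outputs D \<omega>, (\<lambda>k\<in>{..t}. att_output S D a k \<omega>), (\<lambda>k\<in>{..<t}. a k \<omega>)))"

definition optimal_attack where
  "optimal_attack M S D \<alpha> a \<longleftrightarrow> causal_attack M S D a \<and>
     (\<forall>b. causal_attack M S D b \<longrightarrow> J_joint M S D \<alpha> a \<le> J_joint M S D \<alpha> b)"


section \<open>Backward recursions for the closed-form costs\<close>

definition \<Sigma>\<xi>0 :: "('n::finite,'m::finite,'s::finite,'p::finite) plant \<Rightarrow> real^'n blk6^'n blk6" where
  "\<Sigma>\<xi>0 S = (let E = (mat 1 ||| 0 ||| mat 1 ||| 0) :: real^'n blk6^'n;
                 z = (0 /// 0 /// 0 /// target S) :: real^'n blk6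
             in transpose E ** \<Sigma>0 S ** E + (\<chi> i j. z $ i * z $ j))"

definition Acl where "Acl S \<alpha> t = cA S + cB S ** cL S \<alpha> t"
definition Ccl where "Ccl S \<alpha> t = Ctil S + mat\<Psi> S ** cL S \<alpha> t"
definition Dcl where "Dcl S \<alpha> t = mat 1 + mat\<Psi> S ** cO S \<alpha> t"

function Qtil :: "('n::finite,'m::finite,'s::finite,'p::finite) plant \<Rightarrow> real \<Rightarrow> nat \<Rightarrow> real^'n blk6^'n blk6" where
  "Qtil S \<alpha> t =
     (if t \<le> horizon S then
        transpose (Acl S \<alpha> t) ** Qtil S \<alpha> (Suc t) ** Acl S \<alpha> t
        + transpose (Ccl S \<alpha> t) ** matR S t ** Ccl S \<alpha> t
      else 0)"
  by pat_completeness auto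
termination by (relation "Wellfounded.measure (\<lambda>(S, \<alpha>, t). Suc (horizon S) - t)") auto

function Qbar :: "('n::finite,'m::finite,'s::finite,'p::finite) plant \<Rightarrow> real \<Rightarrow> nat \<Rightarrow> real^'n blk6^'n blk6" where
  "Qbar S \<alpha> t =
     (if t \<le> horizon S then
        transpose (Acl S \<alpha> t) ** Qbar S \<alpha> (Suc t) ** Acl S \<alpha> t
        + transpose (cH S) ** matQ S t ** cH S
      else 0)"
  by pat_completeness auto
termination by (relation "Wellfounded.measure (\<lambda>(S, \<alpha>, t). Suc (horizon S) - t)") auto

declare Qtil.simps [simp del] Qbar.simps [simp del]

definition Rtil :: "('n::finite,'m::finite,'s::finite,'p::finite) plant \<Rightarrow> real \<Rightarrow> nat \<Rightarrow> real^'p^'n blk6" where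
  "Rtil S \<alpha> t = transpose (Acl S \<alpha> t) ** Qtil S \<alpha> (Suc t) ** cB S ** cO S \<alpha> t
     + transpose (Ccl S \<alpha> t) ** matR S t ** Dcl S \<alpha> t"

definition Stil :: "('n::finite,'m::finite,'s::finite,'p::finite) plant \<Rightarrow> real \<Rightarrow> nat \<Rightarrow> real^'p^'p" where
  "Stil S \<alpha> t = transpose (cO S \<alpha> t) ** transpose (cB S) ** Qtil S \<alpha> (Suc t) ** cB S ** cO S \<alpha> t
     + transpose (Dcl S \<alpha> t) ** matR S t ** Dcl S \<alpha> t"

definition Rbar :: "('n::finite,'m::finite,'s::finite,'p::finite) plant \<Rightarrow> real \<Rightarrow> nat \<Rightarrow> real^'p^'n blk6" where
  "Rbar S \<alpha> t = transpose (Acl S \<alpha> t) ** Qbar S \<alpha> (Suc t) ** cB S ** cO S \<alpha> t"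

definition Sbar :: "('n::finite,'m::finite,'s::finite,'p::finite) plant \<Rightarrow> real \<Rightarrow> nat \<Rightarrow> real^'p^'p" where
  "Sbar S \<alpha> t = transpose (cO S \<alpha> t) ** transpose (cB S) ** Qbar S \<alpha> (Suc t) ** cB S ** cO S \<alpha> t"

end

theory Submission
  imports Defs
begin

text \<open>
  Write \<open>\<xi>\<^sub>t = \<zeta>\<^sub>t + \<K> \<nu>\<^sub>t\<close>. The feedback form of the attack makes \<open>\<zeta>\<close> a linear recursion
  driven by the innovations, \<open>\<zeta>\<^sub>t\<^sub>+\<^sub>1 = F\<^sub>t \<zeta>\<^sub>t + (F\<^sub>t \<K> + \<B> \<O>\<^sub>t) \<nu>\<^sub>t\<close> with
  \<open>F\<^sub>t = \<A> + \<B> \<L>\<^sub>t\<close>. It also makes the system's innovation and the deviation from the target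
  linear in \<open>\<zeta>\<^sub>t\<close>, \<open>\<nu>\<^sub>t\<close> and the attacker's filtering error. These three are pairwise
  uncorrelated, with second moments \<open>X\<^sub>t\<close>, \<open>\<Sigma>\<^sub>\<nu>\<close> and the posterior error covariance, because
  \<open>K \<Sigma>\<^sub>\<nu> = P C\<^sup>T\<close> and \<open>P\<close> solves the Riccati equation. Each stage cost is then a sum of
  traces, and the backward recursions make \<open>trace (X\<^sub>t Q\<^sub>t)\<close> telescope against the forward
  recursion of \<open>X\<^sub>t\<close>.
\<close>

section \<open>Matrix algebra\<close>

lemma matrix_mult_add_left: "(X + Y) ** Z = X ** Z + Y ** (Z::real^'c^'b)"
  by (simp add: vec_eq_iff matrix_matrix_mult_def distrib_right sum.distrib)

lemma matrix_mult_diff_left: "(X - Y) ** Z = X ** Z - Y ** (Z::real^'c^'b)"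
  by (simp add: vec_eq_iff matrix_matrix_mult_def left_diff_distrib sum_subtractf)

lemma matrix_mult_diff_right: "X ** (Y - Z) = X ** Y - X ** (Z::real^'c^'b)"
  by (simp add: vec_eq_iff matrix_matrix_mult_def right_diff_distrib sum_subtractf)

lemma matrix_mult_zero_left [simp]: "0 ** (Z::real^'c^'b) = 0"
  by (simp add: vec_eq_iff matrix_matrix_mult_def)

lemma matrix_mult_zero_right [simp]: "(Z::real^'c^'b) ** 0 = 0"
  by (simp add: vec_eq_iff matrix_matrix_mult_def)

lemma matrix_mult_scaleR_right: "X ** (c *\<^sub>R Y) = c *\<^sub>R (X ** (Y::real^'c^'b))"
  by (simp add: vec_eq_iff matrix_matrix_mult_def sum_distrib_left mult_ac)

lemma transpose_add: "transpose (X + Y) = transpose X + transpose (Y::real^'c^'b)"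
  by (simp add: vec_eq_iff transpose_def)

lemma transpose_diff: "transpose (X - Y) = transpose X - transpose (Y::real^'c^'b)"
  by (simp add: vec_eq_iff transpose_def)

lemma transpose_zero [simp]: "transpose (0::real^'c^'b) = 0"
  by (simp add: vec_eq_iff transpose_def)

lemma uminus_matrix_vector_mult: "(- X) *v z = - (X *v (z::real^'b))"
  by (simp add: vec_eq_iff matrix_vector_mult_def sum_negf)

lemma trace_scaleR: "trace (c *\<^sub>R X) = c * trace (X::real^'b^'b)"
  by (simp add: trace_def sum_distrib_left)

lemma trace_transpose: "trace (transpose X) = trace (X::real^'b^'b)"
  by (simp add: trace_def transpose_def)

lemma vcat_add: "(a /// b) + (c /// d) = (a + c) /// (b + d)"
  by (simp add: vec_eq_iff vcat_def split: sum.split)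

lemma zero_eq_vcat: "0 = 0 /// 0"
  by (simp add: vec_eq_iff vcat_def split: sum.split)

lemma transpose_hcat: "transpose (X ||| Y) = transpose X /// transpose Y"
  by (simp add: vec_eq_iff vcat_def hcat_def transpose_def split: sum.split)

section \<open>Positive definiteness, and trace identities for the cost recursions\<close>

lemma sym_pd_invertible:
  assumes "sym_pd X"
  shows "invertible X"
proof -
  have "\<And>z. X *v z = 0 \<Longrightarrow> z = 0"
    using assms unfolding sym_pd_def by (metis inner_zero_right less_irrefl)
  then show ?thesis
    by (metis invertible_left_inverse matrix_left_invertible_ker)
qed

lemma matrix_inv_mult_cancel:
  assumes "invertible X"
  shows "matrix_inv X ** X = mat 1"
  using assms unfolding invertible_def matrix_inv_def by (rule someI2_ex) simp

text \<open>Cyclicity of the trace. It trades a covariance pushed forward through \<open>Y\<close>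
  for a weight pulled back through \<open>Y\<close>, which is the link between forward and backward
  recursions.\<close>

lemma trace_conjugate:
  "trace (Y ** X ** transpose Y ** R) = trace (X ** (transpose Y ** R ** (Y::real^'b^'c)))"
  using trace_mul_sym[of Y "X ** transpose Y ** R"] by (simp add: matrix_mul_assoc)

text \<open>By \<open>trace_conjugate\<close>, \<open>trace (X (Suc t) ** Q (Suc t))\<close> splits
  into the pulled-back weight tested on \<open>X t\<close> plus a noise term; the recursion of
  \<open>Q\<close> then makes the sum telescope. That recursion is demanded only below
  \<open>n\<close>, because \<open>Qtil\<close> and \<open>Qbar\<close> obey theirs only up to the
  horizon.\<close>

lemma trace_cost_to_go:
  fixes X Q W :: "nat \<Rightarrow> real^'a^'a" and G :: "nat \<Rightarrow> real^'b^'a"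
  assumes X: "\<And>t. X (Suc t) = F t ** X t ** transpose (F t) + G t ** \<Sigma> ** transpose (G t)"
    and Q: "\<And>t. t < n \<Longrightarrow> Q t = transpose (F t) ** Q (Suc t) ** F t + W t"
  shows "(\<Sum>t<n. trace (X t ** W t)) + trace (X n ** Q n) =
    trace (X 0 ** Q 0) + (\<Sum>t<n. trace (\<Sigma> ** (transpose (G t) ** Q (Suc t) ** G t)))"
  using Q
proof (induction n)
  case (Suc n)
  have "trace (X (Suc n) ** Q (Suc n)) =
      trace (X n ** (transpose (F n) ** Q (Suc n) ** F n))
      + trace (\<Sigma> ** (transpose (G n) ** Q (Suc n) ** G n))"
    by (simp only: X matrix_mult_add_left trace_add trace_conjugate)
  moreover have "trace (X n ** Q n) =
      trace (X n ** (transpose (F n) ** Q (Suc n) ** F n)) + trace (X n ** W n)"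
    using Suc.prems[of n] by (simp add: matrix_add_ldistrib trace_add)
  ultimately show ?case using Suc by simp
qed simp

text \<open>The innovation enters the next state with gain \<open>F ** K + U\<close> and the current
  output with gain \<open>C ** K + E\<close>. When both squares are expanded, the terms quadratic in
  \<open>K\<close> collect to \<open>Q\<close> and the mixed ones to \<open>R\<close> and its
  transpose. The two mixed terms have equal traces against the symmetric \<Sigma>, hence the factor
  2.\<close>

lemma feedback_noise_cost:
  fixes Q F :: "real^'a^'a" and R :: "real^'b^'a" and \<Sigma> :: "real^'b^'b" and C :: "real^'a^'c"
    and W :: "real^'c^'c"
  assumes Q: "transpose Q' = Q'" and W: "transpose W = W" and \<Sigma>: "transpose \<Sigma> = \<Sigma>"
    and rec: "Q = transpose F ** Q' ** F + transpose C ** W ** C"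
    and R: "R = transpose F ** Q' ** U + transpose C ** W ** E"
  shows "trace (\<Sigma> ** (transpose (F ** K + U) ** Q' ** (F ** K + U)))
      + trace (\<Sigma> ** (transpose (C ** K + E) ** W ** (C ** K + E)))
    = trace (\<Sigma> ** (transpose K ** Q ** K + 2 *\<^sub>R (transpose K ** R)
        + (transpose U ** Q' ** U + transpose E ** W ** E)))"
proof -
  have cross: "trace (\<Sigma> ** (transpose R ** K)) = trace (\<Sigma> ** (transpose K ** R))"
    using trace_transpose[of "\<Sigma> ** (transpose R ** K)"] trace_mul_sym[of "transpose K ** R" \<Sigma>]
    by (simp add: matrix_transpose_mul \<Sigma>)
  have "transpose (F ** K + U) ** Q' ** (F ** K + U) + transpose (C ** K + E) ** W ** (C ** K + E)
      = transpose K ** Q ** K + transpose K ** R + transpose R ** K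
        + (transpose U ** Q' ** U + transpose E ** W ** E)"
    by (simp add: rec R transpose_add matrix_transpose_mul Q W matrix_mult_add_left
        matrix_add_ldistrib matrix_mul_assoc)
  then have "trace (\<Sigma> ** (transpose (F ** K + U) ** Q' ** (F ** K + U)))
      + trace (\<Sigma> ** (transpose (C ** K + E) ** W ** (C ** K + E)))
      = trace (\<Sigma> ** (transpose K ** Q ** K + transpose K ** R + transpose R ** K
        + (transpose U ** Q' ** U + transpose E ** W ** E)))"
    by (simp flip: trace_add matrix_add_ldistrib)
  also have "\<dots> = trace (\<Sigma> ** (transpose K ** Q ** K + 2 *\<^sub>R (transpose K ** R)
        + (transpose U ** Q' ** U + transpose E ** W ** E)))"
    by (simp add: trace_add matrix_add_ldistrib cross matrix_mult_scaleR_right trace_scaleR)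
  finally show ?thesis .
qed

section \<open>Second moments of random vectors\<close>

lemma borel_measurable_vec_nth: "(\<lambda>x::real^'b. x $ i) \<in> borel_measurable borel"
  by (intro borel_measurable_continuous_onI continuous_intros)

definition square_integrable :: "'w measure \<Rightarrow> ('w \<Rightarrow> real^'a) \<Rightarrow> bool" where
  "square_integrable M X \<longleftrightarrow> X \<in> borel_measurable M \<and> integrable M (\<lambda>\<omega>. (norm (X \<omega>))\<^sup>2)"

text \<open>Uncentred on purpose: the augmented state has the constant target as a block, which a
  covariance would lose. A non-integrable entry reads as 0, whence the square-integrability premises
  of the linearity rules.\<close>

definition second_moment :: "'w measure \<Rightarrow> ('w \<Rightarrow> real^'a) \<Rightarrow> ('w \<Rightarrow> real^'b) \<Rightarrow> real^'b^'a" where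
  "second_moment M X Y = (\<chi> i j. \<integral>\<omega>. X \<omega> $ i * Y \<omega> $ j \<partial>M)"

lemma square_integrable_add:
  fixes X :: "'w \<Rightarrow> real^'a" and Y :: "'w \<Rightarrow> real^'a"
  assumes "square_integrable M X" "square_integrable M Y"
  shows "square_integrable M (\<lambda>\<omega>. X \<omega> + Y \<omega>)"
  unfolding square_integrable_def
proof
  have [measurable]: "X \<in> borel_measurable M" "Y \<in> borel_measurable M"
    and i: "integrable M (\<lambda>\<omega>. (norm (X \<omega>))\<^sup>2)" "integrable M (\<lambda>\<omega>. (norm (Y \<omega>))\<^sup>2)"
    using assms by (auto simp: square_integrable_def)
  show "(\<lambda>\<omega>. X \<omega> + Y \<omega>) \<in> borel_measurable M" by measurable
  have *: "(norm (x + y))\<^sup>2 \<le> 2 * (norm x)\<^sup>2 + 2 * (norm y)\<^sup>2" for x y :: "real^'a"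
  proof -
    have "(norm (x + y))\<^sup>2 \<le> (norm x + norm y)\<^sup>2"
      by (intro power_mono norm_triangle_ineq) simp
    also have "\<dots> \<le> 2 * (norm x)\<^sup>2 + 2 * (norm y)\<^sup>2"
      using sum_squares_bound[of "norm x" "norm y"] by (simp add: power2_sum)
    finally show ?thesis .
  qed
  show "integrable M (\<lambda>\<omega>. (norm (X \<omega> + Y \<omega>))\<^sup>2)"
    by (rule Bochner_Integration.integrable_bound
        [where f = "\<lambda>\<omega>. 2 * (norm (X \<omega>))\<^sup>2 + 2 * (norm (Y \<omega>))\<^sup>2"])
      (use i * in \<open>auto\<close>)
qed

lemma square_integrable_matrix_mult:
  fixes L :: "real^'a^'b" and X :: "'w \<Rightarrow> real^'a"
  assumes "square_integrable M X"
  shows "square_integrable M (\<lambda>\<omega>. L *v X \<omega>)"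
  unfolding square_integrable_def
proof
  have [measurable]: "X \<in> borel_measurable M" and i: "integrable M (\<lambda>\<omega>. (norm (X \<omega>))\<^sup>2)"
    using assms by (auto simp: square_integrable_def)
  have "(*v) L \<in> borel_measurable borel"
    by (intro borel_measurable_continuous_onI linear_continuous_on) simp
  then show [measurable]: "(\<lambda>\<omega>. L *v X \<omega>) \<in> borel_measurable M" by measurable
  obtain c where c: "\<And>x. norm (L *v x) \<le> norm x * c"
    using bounded_linear.bounded[of "(*v) L"] by auto
  have *: "(norm (L *v x))\<^sup>2 \<le> c\<^sup>2 * (norm x)\<^sup>2" for x
    using power_mono[OF c, of x 2] by (simp add: power_mult_distrib mult.commute)
  show "integrable M (\<lambda>\<omega>. (norm (L *v X \<omega>))\<^sup>2)"
    by (rule Bochner_Integration.integrable_bound[where f = "\<lambda>\<omega>. c\<^sup>2 * (norm (X \<omega>))\<^sup>2"])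
      (use i * in \<open>auto\<close>)
qed

lemma square_integrable_diff:
  assumes "square_integrable M X" "square_integrable M Y"
  shows "square_integrable M (\<lambda>\<omega>. X \<omega> - Y \<omega>)"
  using square_integrable_add[OF assms(1) square_integrable_matrix_mult[OF assms(2), of "- mat 1"]]
  by (simp add: uminus_matrix_vector_mult)

lemma square_integrable_mult:
  fixes X :: "'w \<Rightarrow> real^'a" and Y :: "'w \<Rightarrow> real^'b"
  assumes "square_integrable M X" "square_integrable M Y"
  shows "integrable M (\<lambda>\<omega>. X \<omega> $ i * Y \<omega> $ j)"
proof -
  have [measurable]: "X \<in> borel_measurable M" "Y \<in> borel_measurable M"
    and i: "integrable M (\<lambda>\<omega>. (norm (X \<omega>))\<^sup>2)" "integrable M (\<lambda>\<omega>. (norm (Y \<omega>))\<^sup>2)"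
    using assms by (auto simp: square_integrable_def)
  have [measurable]: "(\<lambda>\<omega>. X \<omega> $ i) \<in> borel_measurable M" "(\<lambda>\<omega>. Y \<omega> $ j) \<in> borel_measurable M"
    by (auto intro: measurable_compose[OF _ borel_measurable_vec_nth])
  have *: "\<bar>x $ i * y $ j\<bar> \<le> (norm x)\<^sup>2 + (norm y)\<^sup>2" for x :: "real^'a" and y :: "real^'b"
  proof -
    have "\<bar>x $ i * y $ j\<bar> \<le> norm x * norm y"
      unfolding abs_mult by (intro mult_mono component_le_norm_cart) auto
    also have "\<dots> \<le> (norm x)\<^sup>2 + (norm y)\<^sup>2"
      using sum_squares_bound[of "norm x" "norm y"] mult_nonneg_nonneg[OF norm_ge_zero[of x] norm_ge_zero[of y]]
      by linarith
    finally show ?thesis .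
  qed
  show ?thesis
    by (rule Bochner_Integration.integrable_bound
        [where f = "\<lambda>\<omega>. (norm (X \<omega>))\<^sup>2 + (norm (Y \<omega>))\<^sup>2"])
      (use i * in \<open>auto\<close>)
qed

lemma (in prob_space) square_integrable_const: "square_integrable M (\<lambda>_. c)"
  by (simp add: square_integrable_def)

lemma second_moment_transpose: "transpose (second_moment M X Y) = second_moment M Y X"
  by (simp add: second_moment_def transpose_def vec_eq_iff mult.commute)

lemma second_moment_zero_swap: "second_moment M X Y = 0 \<Longrightarrow> second_moment M Y X = 0"
  using second_moment_transpose[of M X Y] by simp

lemma second_moment_add_left:
  assumes "square_integrable M X" "square_integrable M Y" "square_integrable M Z"
  shows "second_moment M (\<lambda>\<omega>. X \<omega> + Y \<omega>) Z = second_moment M X Z + second_moment M Y Z"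
  using assms
  by (simp add: second_moment_def vec_eq_iff distrib_right square_integrable_mult)

lemma second_moment_diff_left:
  assumes "square_integrable M X" "square_integrable M Y" "square_integrable M Z"
  shows "second_moment M (\<lambda>\<omega>. X \<omega> - Y \<omega>) Z = second_moment M X Z - second_moment M Y Z"
  using assms
  by (simp add: second_moment_def vec_eq_iff left_diff_distrib square_integrable_mult)

lemma second_moment_mult_left:
  assumes "square_integrable M X" "square_integrable M Z"
  shows "second_moment M (\<lambda>\<omega>. L *v X \<omega>) Z = L ** second_moment M X Z"
proof -
  have "(\<integral>\<omega>. (L *v X \<omega>) $ i * Z \<omega> $ j \<partial>M)
      = (\<Sum>k\<in>UNIV. L $ i $ k * (\<integral>\<omega>. X \<omega> $ k * Z \<omega> $ j \<partial>M))" for i j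
    using square_integrable_mult[OF assms]
    by (simp add: matrix_vector_mult_def sum_distrib_right mult.assoc)
  then show ?thesis
    by (simp add: second_moment_def vec_eq_iff matrix_matrix_mult_def)
qed

lemma second_moment_add_right:
  assumes "square_integrable M X" "square_integrable M Y" "square_integrable M Z"
  shows "second_moment M Z (\<lambda>\<omega>. X \<omega> + Y \<omega>) = second_moment M Z X + second_moment M Z Y"
  using arg_cong[OF second_moment_add_left[OF assms], of transpose]
  by (simp only: transpose_add second_moment_transpose)

lemma second_moment_diff_right:
  assumes "square_integrable M X" "square_integrable M Y" "square_integrable M Z"
  shows "second_moment M Z (\<lambda>\<omega>. X \<omega> - Y \<omega>) = second_moment M Z X - second_moment M Z Y"
  using arg_cong[OF second_moment_diff_left[OF assms], of transpose]
  by (simp only: transpose_diff second_moment_transpose)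

lemma second_moment_mult_right:
  assumes "square_integrable M X" "square_integrable M Z"
  shows "second_moment M Z (\<lambda>\<omega>. L *v X \<omega>) = second_moment M Z X ** transpose L"
  using arg_cong[OF second_moment_mult_left[OF assms], of transpose]
  by (simp only: matrix_transpose_mul second_moment_transpose)

lemmas second_moment_linear =
  second_moment_add_left second_moment_add_right second_moment_diff_left second_moment_diff_right
  second_moment_mult_left second_moment_mult_right

lemmas square_integrable_intros =
  square_integrable_add square_integrable_diff square_integrable_matrix_mult

text \<open>A quadratic form is a finite combination of products of two components, so its mean
  depends on the law only through the second moments.\<close>

lemma
  fixes R :: "real^'a^'a" and X :: "'w \<Rightarrow> real^'a"
  assumes "square_integrable M X"
  shows integrable_quadratic_form: "integrable M (\<lambda>\<omega>. X \<omega> \<bullet> (R *v X \<omega>))"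
    and integral_quadratic_form:
      "(\<integral>\<omega>. X \<omega> \<bullet> (R *v X \<omega>) \<partial>M) = trace (second_moment M X X ** R)"
proof -
  have eq: "X \<omega> \<bullet> (R *v X \<omega>) = (\<Sum>i\<in>UNIV. \<Sum>j\<in>UNIV. (X \<omega> $ i * X \<omega> $ j) * R $ i $ j)" for \<omega>
    by (simp add: inner_vec_def matrix_vector_mult_def sum_distrib_left mult_ac)
  note i = square_integrable_mult[OF assms assms]
  show "integrable M (\<lambda>\<omega>. X \<omega> \<bullet> (R *v X \<omega>))"
    unfolding eq by (intro Bochner_Integration.integrable_sum integrable_mult_left i)
  have "(\<integral>\<omega>. X \<omega> \<bullet> (R *v X \<omega>) \<partial>M)
      = (\<Sum>i\<in>UNIV. \<Sum>j\<in>UNIV. (\<integral>\<omega>. X \<omega> $ i * X \<omega> $ j \<partial>M) * R $ i $ j)"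
    unfolding eq using i by (simp add: Bochner_Integration.integrable_sum)
  \<comment> \<open>Swapping the sums and the two commuting factors puts the indices in the order of
    the trace of a matrix product.\<close>
  also have "\<dots> = (\<Sum>j\<in>UNIV. \<Sum>i\<in>UNIV. second_moment M X X $ j $ i * R $ i $ j)"
    by (subst sum.swap) (simp add: second_moment_def mult.commute)
  finally show "(\<integral>\<omega>. X \<omega> \<bullet> (R *v X \<omega>) \<partial>M) = trace (second_moment M X X ** R)"
    by (simp add: trace_def matrix_matrix_mult_def)
qed

section \<open>Second moments from Gaussian laws and from independence\<close>

context prob_space
begin

lemma gaussian_vector_linear_functional:
  assumes "gaussian_vector M 0 \<Sigma> X"
  shows "integrable M (\<lambda>\<omega>. (c \<bullet> X \<omega>)\<^sup>2)" "(\<integral>\<omega>. c \<bullet> X \<omega> \<partial>M) = 0"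
    "(\<integral>\<omega>. (c \<bullet> X \<omega>)\<^sup>2 \<partial>M) = c \<bullet> (\<Sigma> *v c)"
proof -
  have [measurable]: "X \<in> borel_measurable M" and nn: "0 \<le> c \<bullet> (\<Sigma> *v c)"
    using assms by (auto simp: gaussian_vector_def sym_psd_def)
  have "integrable M (\<lambda>\<omega>. (c \<bullet> X \<omega>)\<^sup>2) \<and> (\<integral>\<omega>. c \<bullet> X \<omega> \<partial>M) = 0
    \<and> (\<integral>\<omega>. (c \<bullet> X \<omega>)\<^sup>2 \<partial>M) = c \<bullet> (\<Sigma> *v c)"
  proof (cases "c \<bullet> (\<Sigma> *v c) = 0")
    case True
    then have *: "AE \<omega> in M. c \<bullet> X \<omega> = 0"
      using assms unfolding gaussian_vector_def by (metis inner_zero_right)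
    have "integrable M (\<lambda>\<omega>. (c \<bullet> X \<omega>)\<^sup>2) \<longleftrightarrow> integrable M (\<lambda>\<omega>. 0::real)"
      using * by (intro integrable_cong_AE) auto
    moreover have "(\<integral>\<omega>. c \<bullet> X \<omega> \<partial>M) = (\<integral>\<omega>. 0 \<partial>M)" "(\<integral>\<omega>. (c \<bullet> X \<omega>)\<^sup>2 \<partial>M) = (\<integral>\<omega>. 0 \<partial>M)"
      by (intro integral_cong_AE; use * in force)+
    ultimately show ?thesis using True by simp
  next
    case False
    let ?s = "sqrt (c \<bullet> (\<Sigma> *v c))"
    have s: "0 < ?s" using False nn by simp
    have d: "distributed M lborel (\<lambda>\<omega>. c \<bullet> X \<omega>) (normal_density 0 ?s)"
      using assms False unfolding gaussian_vector_def by (metis inner_zero_right)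
    have e: "(\<integral>\<omega>. c \<bullet> X \<omega> \<partial>M) = 0" using normal_distributed_expectation[OF s d] .
    have v: "(\<integral>\<omega>. (c \<bullet> X \<omega>)\<^sup>2 \<partial>M) = ?s\<^sup>2" using normal_distributed_variance[OF s d] e by simp
    \<comment> \<open>A non-integrable function has Bochner integral 0, whereas this integral is the
      positive number \<open>?s\<^sup>2\<close>.\<close>
    have "integrable M (\<lambda>\<omega>. (c \<bullet> X \<omega>)\<^sup>2)"
      using v s not_integrable_integral_eq by fastforce
    with e v nn show ?thesis by simp
  qed
  then show "integrable M (\<lambda>\<omega>. (c \<bullet> X \<omega>)\<^sup>2)" "(\<integral>\<omega>. c \<bullet> X \<omega> \<partial>M) = 0"
    "(\<integral>\<omega>. (c \<bullet> X \<omega>)\<^sup>2 \<partial>M) = c \<bullet> (\<Sigma> *v c)" by auto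
qed

lemma gaussian_vector_square_integrable:
  fixes X :: "'a \<Rightarrow> real^'n"
  assumes "gaussian_vector M 0 \<Sigma> X"
  shows "square_integrable M X"
proof -
  have "integrable M (\<lambda>\<omega>. \<Sum>i\<in>UNIV. (axis i 1 \<bullet> X \<omega>)\<^sup>2)"
    by (intro Bochner_Integration.integrable_sum gaussian_vector_linear_functional[OF assms])
  moreover have "(norm x)\<^sup>2 = (\<Sum>i\<in>UNIV. (axis i 1 \<bullet> x)\<^sup>2)" for x :: "real^'n"
    unfolding inner_axis' power2_norm_eq_inner by (simp add: inner_vec_def power2_eq_square)
  ultimately show ?thesis
    using assms by (simp add: square_integrable_def gaussian_vector_def)
qed

lemma gaussian_vector_expectation:
  assumes "gaussian_vector M 0 \<Sigma> X"
  shows "(\<integral>\<omega>. X \<omega> $ i \<partial>M) = 0"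
  using gaussian_vector_linear_functional(2)[OF assms, of "axis i 1"] by (simp add: inner_axis')

text \<open>The law is known through single linear functionals only. Polarisation recovers the mixed
  moments from the variances along two axes and along their sum, and symmetry of \<Sigma> merges the
  two off-diagonal entries.\<close>

lemma gaussian_vector_second_moment:
  fixes X :: "'a \<Rightarrow> real^'n"
  assumes "gaussian_vector M 0 \<Sigma> X"
  shows "second_moment M X X = \<Sigma>"
proof -
  have sym: "\<Sigma> $ j $ i = \<Sigma> $ i $ j" for i j
  proof -
    have "transpose \<Sigma> = \<Sigma>" using assms by (simp add: gaussian_vector_def sym_psd_def)
    from arg_cong[OF this, of "\<lambda>Z. Z $ i $ j"] show ?thesis by (simp add: transpose_def)
  qed
  have ax: "axis i 1 \<bullet> (\<Sigma> *v axis j 1) = \<Sigma> $ i $ j" for i j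
    by (simp add: inner_axis' matrix_vector_mult_basis column_def)
  note q = gaussian_vector_linear_functional[OF assms]
  have "(\<integral>\<omega>. X \<omega> $ i * X \<omega> $ j \<partial>M) = \<Sigma> $ i $ j" for i j
  proof -
    let ?a = "axis i 1 :: real^'n" and ?b = "axis j 1 :: real^'n"
    have eq: "X \<omega> $ i * X \<omega> $ j
        = (((?a + ?b) \<bullet> X \<omega>)\<^sup>2 - (?a \<bullet> X \<omega>)\<^sup>2 - (?b \<bullet> X \<omega>)\<^sup>2) / 2" for \<omega>
      by (simp add: inner_add_left inner_axis' power2_eq_square algebra_simps)
    show ?thesis
      unfolding eq using q(1)[of "?a + ?b"] q(1)[of ?a] q(1)[of ?b] q(3)[of "?a + ?b"]
      by (simp add: q(3) ax sym[of i j] matrix_vector_right_distrib inner_add_left inner_add_right)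
  qed
  then show ?thesis by (simp add: second_moment_def vec_eq_iff)
qed

lemma second_moment_const_right:
  assumes "\<And>i. (\<integral>\<omega>. X \<omega> $ i \<partial>M) = 0"
  shows "second_moment M X (\<lambda>_. c) = 0"
  using assms by (simp add: second_moment_def vec_eq_iff)

lemma indep_var_second_moment:
  fixes X :: "'a \<Rightarrow> real^'b" and Y :: "'a \<Rightarrow> real^'c"
  assumes "\<And>i j. indep_var borel (\<lambda>\<omega>. X \<omega> $ i) borel (\<lambda>\<omega>. Y \<omega> $ j)"
    "square_integrable M X" "square_integrable M Y" "\<And>i. (\<integral>\<omega>. X \<omega> $ i \<partial>M) = 0"
  shows "second_moment M X Y = 0"
proof -
  \<comment> \<open>A component is its own product with a component of the constant vector 1, so
    finiteness of the measure turns square integrability into integrability.\<close>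
  have int: "integrable M (\<lambda>\<omega>. Z \<omega> $ i)" if "square_integrable M Z" for Z :: "'a \<Rightarrow> real^'d" and i
    using square_integrable_mult[OF that square_integrable_const[of "1::real^'d"], of i i] by simp
  have "(\<integral>\<omega>. X \<omega> $ i * Y \<omega> $ j \<partial>M) = 0" for i j
    using indep_var_lebesgue_integral[OF assms(1) int[OF assms(2)] int[OF assms(3)]] assms(4)
    by simp
  then show ?thesis by (simp add: second_moment_def vec_eq_iff)
qed

text \<open>\<open>indep_rv\<close> makes the generated sigma-algebras independent, and a map
  measurable for such an algebra generates a smaller one. Thus a quantity known only to be
  measurable in the past inherits independence, without being exhibited as a function of it.\<close>

lemma indep_rv_imp_indep_var:
  assumes ind: "indep_rv M N U N' V"
    and X: "X \<in> measurable (vimage_algebra (space M) U N) K"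
    and Y: "Y \<in> measurable (vimage_algebra (space M) V N') K'"
  shows "indep_var K X K' Y"
proof -
  have U: "U \<in> measurable M N" and V: "V \<in> measurable M N'"
    and i: "indep_set (sets (vimage_algebra (space M) U N)) (sets (vimage_algebra (space M) V N'))"
    using ind by (auto simp: indep_rv_def)
  have gen: "sigma_sets (space M) {Z -` A \<inter> space M | A. A \<in> sets L} \<subseteq> sets F"
    if "Z \<in> measurable F L" "space F = space M" for F :: "'a measure" and Z and L :: "'z measure"
    unfolding that(2)[symmetric] using that(1)
    by (intro sets.sigma_sets_subset) (auto dest: measurable_sets)
  \<comment> \<open>The generated algebra is coarser than \<open>M\<close>: the identity is
    measurable from \<open>M\<close> into it.\<close>
  have lift: "Z \<in> measurable M L"
    if "Z \<in> measurable (vimage_algebra (space M) T H) L" "T \<in> measurable M H"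
    for Z T and H :: "'h measure" and L :: "'z measure"
    using measurable_comp[OF measurable_vimage_algebra2[of id M "space M" T H] that(1)] that(2)
    by (simp add: id_def comp_def)
  note gX = gen[OF X space_vimage_algebra] and gY = gen[OF Y space_vimage_algebra]
  note i' = i[unfolded indep_sets2_eq]
  show ?thesis
    unfolding indep_var_eq indep_sets2_eq
  proof (intro conjI ballI)
    show "random_variable K X" "random_variable K' Y" by (rule lift[OF X U] lift[OF Y V])+
    show "sigma_sets (space M) {X -` A \<inter> space M |A. A \<in> sets K} \<subseteq> events"
      using gX i' by (meson order_trans)
    show "sigma_sets (space M) {Y -` A \<inter> space M |A. A \<in> sets K'} \<subseteq> events"
      using gY i' by (meson order_trans)
  next
    fix a b
    assume "a \<in> sigma_sets (space M) {X -` A \<inter> space M |A. A \<in> sets K}"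
      "b \<in> sigma_sets (space M) {Y -` A \<inter> space M |A. A \<in> sets K'}"
    then have "a \<in> sets (vimage_algebra (space M) U N)" "b \<in> sets (vimage_algebra (space M) V N')"
      using gX gY by (auto dest: subsetD)
    then show "prob (a \<inter> b) = prob a * prob b"
      using i' by blast
  qed
qed

end

section \<open>Dynamics under the attack\<close>

text \<open>
  The same input and attack enter the plant and the attacker's filter, so the filter's errors and
  innovations do not depend on the attack and can be defined from the noise alone.
\<close>

fun pred_error ::
  "('n::finite,'m::finite,'s::finite,'p::finite) plant \<Rightarrow> ('w,'n,'p) scenario \<Rightarrow> nat \<Rightarrow> 'w \<Rightarrow> real^'n" where
  "pred_error S D 0 \<omega> = preX D 0 \<omega> - prePred D 0 \<omega>"
| "pred_error S D (Suc t) \<omega> =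
     matA S *v (pred_error S D t \<omega>
       - matK S *v (matC S *v pred_error S D t \<omega> + noiseV D (int t) \<omega>)) + noiseW D (int t) \<omega>"

definition innov ::
  "('n::finite,'m::finite,'s::finite,'p::finite) plant \<Rightarrow> ('w,'n,'p) scenario \<Rightarrow> nat \<Rightarrow> 'w \<Rightarrow> real^'p" where
  "innov S D t \<omega> = matC S *v pred_error S D t \<omega> + noiseV D (int t) \<omega>"

definition filt_error ::
  "('n::finite,'m::finite,'s::finite,'p::finite) plant \<Rightarrow> ('w,'n,'p) scenario \<Rightarrow> nat \<Rightarrow> 'w \<Rightarrow> real^'n" where
  "filt_error S D t \<omega> = pred_error S D t \<omega> - matK S *v innov S D t \<omega>"

lemma pred_error_Suc:
  "pred_error S D (Suc t) \<omega> = matA S *v filt_error S D t \<omega> + noiseW D (int t) \<omega>"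
  by (simp add: pred_error.simps filt_error_def innov_def)

declare pred_error.simps [simp del]

section \<open>The attacker's filter, the attack-free run and the effect of the attack\<close>

lemma plant_state_minus_att_pred:
  "plant_state S D a t \<omega> - att_pred S D a t \<omega> = pred_error S D t \<omega>"
proof (induction t)
  case 0
  then show ?case by (simp add: closed_loop_0 pred_error.simps)
next
  case (Suc t)
  have x: "plant_state S D a t \<omega> = pred_error S D t \<omega> + att_pred S D a t \<omega>"
    using Suc by (simp add: algebra_simps)
  show ?case
    by (simp add: plant_state_Suc pred_error_Suc filt_error_def innov_def att_output_def x
        algebra_simps)
qed

lemma att_innov_eq: "att_innov S D a t \<omega> = innov S D t \<omega>"
  by (simp add: att_innov_def innov_def att_output_def algebra_simps
      flip: plant_state_minus_att_pred[of S D a])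

lemma plant_state_minus_att_est:
  "plant_state S D a t \<omega> - att_est S D a t \<omega> = filt_error S D t \<omega>"
  using plant_state_minus_att_pred[of S D a t \<omega>]
  by (simp add: att_est_def filt_error_def att_innov_eq algebra_simps)

lemma att_est_Suc:
  "att_est S D a (Suc t) \<omega> = matA S *v att_est S D a t \<omega>
     + matB S *v (matL S *v sys_est S D a t \<omega>) + mat\<Gamma> S *v a t \<omega> + matK S *v innov S D (Suc t) \<omega>"
  by (simp add: att_est_def att_innov_eq sys_in_def)
    (simp add: att_innov_eq[of S D a t, symmetric] att_innov_def)

lemma att_est_0: "att_est S D a 0 \<omega> = prePred D 0 \<omega> + matK S *v innov S D 0 \<omega>"
  by (simp add: att_est_def att_innov_eq)

text \<open>Without an attack both filters read the same output. They differ only in how they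
  predict, one by \<open>matABL S\<close>, the other by the plant model with the actual input; as
  that input is \<open>matL S\<close> times the system's estimate, the predictions agree once the
  estimates do, and conversely.\<close>

lemma
  shows sys_est_no_attack: "sys_est S D (\<lambda>_ _. 0) t \<omega> = att_est S D (\<lambda>_ _. 0) t \<omega>"
    and sys_innov_no_attack: "sys_innov S D (\<lambda>_ _. 0) t \<omega> = innov S D t \<omega>"
proof -
  have *: "sys_pred S D (\<lambda>_ _. 0) t \<omega> = att_pred S D (\<lambda>_ _. 0) t \<omega> \<and>
    sys_est S D (\<lambda>_ _. 0) t \<omega> = att_est S D (\<lambda>_ _. 0) t \<omega>"
  proof (induction t)
    case 0
    then show ?case
      by (simp add: closed_loop_0 sys_est_def att_est_def sys_innov_def att_innov_def sys_out_def
          att_output_def)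
  next
    case (Suc t)
    have "sys_pred S D (\<lambda>_ _. 0) (Suc t) \<omega> = att_pred S D (\<lambda>_ _. 0) (Suc t) \<omega>"
      using Suc by (simp add: sys_pred_Suc att_est_def att_innov_def sys_in_def matABL_def
          matrix_vector_mult_add_rdistrib matrix_vector_mul_assoc)
    then show ?case
      by (simp add: sys_est_def att_est_def sys_innov_def att_innov_def sys_out_def att_output_def)
  qed
  then show "sys_est S D (\<lambda>_ _. 0) t \<omega> = att_est S D (\<lambda>_ _. 0) t \<omega>" ..
  show "sys_innov S D (\<lambda>_ _. 0) t \<omega> = innov S D t \<omega>"
    using * by (simp add: sys_innov_def sys_out_def att_output_def att_innov_def
        flip: att_innov_eq[of S D "\<lambda>_ _. 0"])
qed

lemma sys_est_no_attack_Suc: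
  "sys_est S D (\<lambda>_ _. 0) (Suc t) \<omega> =
     (matA S + matB S ** matL S) *v sys_est S D (\<lambda>_ _. 0) t \<omega> + matK S *v innov S D (Suc t) \<omega>"
  by (simp add: sys_est_no_attack att_est_Suc matrix_vector_mult_add_rdistrib matrix_vector_mul_assoc)

text \<open>The blocks have a meaning after time 0. \<open>p\<close> is the change of the system's
  estimate one step earlier, so that \<open>matB S *v (matL S *v p)\<close> is the effect of the
  latest input; \<open>q\<close> carries the changes of older inputs, propagated by
  \<open>matA S\<close>; \<open>r\<close> is the direct response to the attack through
  \<open>mat\<Gamma> S\<close>.\<close>

lemma effect_state_blocks:
  obtains p q r where "effect_state S a t \<omega> = p /// q /// r"
    "plant_state S D a t \<omega> = plant_state S D (\<lambda>_ _. 0) t \<omega> + matB S *v (matL S *v p) + q + r"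
    "sys_pred S D a t \<omega> = sys_pred S D (\<lambda>_ _. 0) t \<omega> + matABL S *v p"
proof -
  have "\<exists>p q r. effect_state S a t \<omega> = p /// q /// r
    \<and> plant_state S D a t \<omega> = plant_state S D (\<lambda>_ _. 0) t \<omega> + matB S *v (matL S *v p) + q + r
    \<and> sys_pred S D a t \<omega> = sys_pred S D (\<lambda>_ _. 0) t \<omega> + matABL S *v p"
  proof (induction t)
    case 0
    have "effect_state S a 0 \<omega> = 0 /// 0 /// 0" by (simp flip: zero_eq_vcat)
    then show ?case
      by (intro exI[of _ 0]) (simp add: closed_loop_0)
  next
    case (Suc t)
    then obtain p q r where
      e: "effect_state S a t \<omega> = p /// q /// r" and
      x: "plant_state S D a t \<omega> = plant_state S D (\<lambda>_ _. 0) t \<omega> + matB S *v (matL S *v p) + q + r" and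
      z: "sys_pred S D a t \<omega> = sys_pred S D (\<lambda>_ _. 0) t \<omega> + matABL S *v p" by blast
    \<comment> \<open>The new first block is the change of the estimate at time \<open>t\<close>, as
      \<open>est\<close> confirms.\<close>
    let ?p = "\<Omega>row S *v (p /// q /// r) + matK S *v (mat\<Psi> S *v a t \<omega>)"
    have est: "sys_est S D a t \<omega> = sys_est S D (\<lambda>_ _. 0) t \<omega> + ?p"
      by (simp add: sys_est_def sys_innov_def sys_out_def x z \<Omega>row_def hcat_mult_vcat matABL_def
          algebra_simps flip: matrix_vector_mul_assoc)
    show ?case
      by (intro exI[of _ ?p] exI[of _ "matA S *v (matB S *v (matL S *v p)) + matA S *v q"]
          exI[of _ "matA S *v r + mat\<Gamma> S *v a t \<omega>"] conjI)
        (simp_all add: e Ahat_def Bhat_def vcat_mult_vec hcat_mult_vcat vcat_add \<Omega>row_def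
          plant_state_Suc sys_in_def sys_pred_Suc est x algebra_simps flip: matrix_vector_mul_assoc)
  qed
  then show ?thesis using that by blast
qed

text \<open>The input effect of \<open>p\<close> occurs both in the state and in the prediction and
  cancels in their difference; this leaves the block \<open>- (matC S ** matA S)\<close> of
  \<open>Chat\<close>.\<close>

lemma sys_innov_eq:
  "sys_innov S D a t \<omega> = innov S D t \<omega> + Chat S *v effect_state S a t \<omega> + mat\<Psi> S *v a t \<omega>"
proof -
  obtain p q r where *: "effect_state S a t \<omega> = p /// q /// r"
    "plant_state S D a t \<omega> = plant_state S D (\<lambda>_ _. 0) t \<omega> + matB S *v (matL S *v p) + q + r"
    "sys_pred S D a t \<omega> = sys_pred S D (\<lambda>_ _. 0) t \<omega> + matABL S *v p"
    by (rule effect_state_blocks)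
  show ?thesis
    by (simp add: * sys_innov_no_attack[symmetric] sys_innov_def sys_out_def Chat_def hcat_mult_vcat matABL_def
        uminus_matrix_vector_mult algebra_simps flip: matrix_vector_mul_assoc)
qed

lemma sys_est_eq:
  "sys_est S D a t \<omega> = sys_est S D (\<lambda>_ _. 0) t \<omega> + \<Omega>row S *v effect_state S a t \<omega>
     + matK S *v (mat\<Psi> S *v a t \<omega>)"
proof -
  obtain p q r where *: "effect_state S a t \<omega> = p /// q /// r"
    "plant_state S D a t \<omega> = plant_state S D (\<lambda>_ _. 0) t \<omega> + matB S *v (matL S *v p) + q + r"
    "sys_pred S D a t \<omega> = sys_pred S D (\<lambda>_ _. 0) t \<omega> + matABL S *v p"
    by (rule effect_state_blocks)
  show ?thesis
    by (simp add: * sys_est_def sys_innov_def sys_out_def \<Omega>row_def hcat_mult_vcat matABL_def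
        algebra_simps flip: matrix_vector_mul_assoc)
qed

section \<open>The augmented state and its closed loop\<close>

lemma aug_state_0:
  "aug_state S D a 0 \<omega> = (prePred D 0 \<omega> /// 0 /// prePred D 0 \<omega> /// target S)
     + cK S *v innov S D 0 \<omega>"
  by (simp add: aug_state_def sys_est_no_attack att_est_0 cK_def vcat_mult_vec vcat_add)

text \<open>The attack reaches the estimate both directly and through the input, because by
  \<open>sys_est_eq\<close> the system's estimate reacts to it within the same step. The second path
  is the summand of \<open>cB\<close> containing \<open>mat\<Psi> S\<close>.\<close>

lemma aug_state_Suc:
  "aug_state S D a (Suc t) \<omega> =
     cA S *v aug_state S D a t \<omega> + cB S *v a t \<omega> + cK S *v innov S D (Suc t) \<omega>"
  by (simp add: aug_state_def sys_est_no_attack_Suc att_est_Suc sys_est_eq[of S D a t] cK_def cA_def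
      cB_def vcat_mult_vec hcat_mult_vcat vcat_add algebra_simps flip: matrix_vector_mul_assoc)

lemma sys_innov_aug_state:
  "sys_innov S D a t \<omega> = innov S D t \<omega> + Ctil S *v aug_state S D a t \<omega> + mat\<Psi> S *v a t \<omega>"
  by (simp add: sys_innov_eq aug_state_def Ctil_def hcat_mult_vcat)

lemma plant_state_aug_state:
  "plant_state S D a t \<omega> - target S = filt_error S D t \<omega> + cH S *v aug_state S D a t \<omega>"
  by (simp add: aug_state_def cH_def hcat_mult_vcat uminus_matrix_vector_mult
      flip: plant_state_minus_att_est[of S D a])

text \<open>
  The augmented state minus the contribution \<open>cK S *v innov S D t \<omega>\<close> of the current innovation:
  unlike the augmented state itself, it is uncorrelated with that innovation.
\<close>

fun aug_pred ::
  "('n::finite,'m::finite,'s::finite,'p::finite) plant \<Rightarrow> ('w,'n,'p) scenario \<Rightarrow> real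
    \<Rightarrow> nat \<Rightarrow> 'w \<Rightarrow> real^'n blk6" where
  "aug_pred S D \<alpha> 0 \<omega> = prePred D 0 \<omega> /// 0 /// prePred D 0 \<omega> /// target S"
| "aug_pred S D \<alpha> (Suc t) \<omega> = Acl S \<alpha> t *v aug_pred S D \<alpha> t \<omega>
     + (Acl S \<alpha> t ** cK S + cB S ** cO S \<alpha> t) *v innov S D t \<omega>"

declare aug_pred.simps [simp del]

text \<open>With the split known at time \<open>t\<close>, the feedback law sends both parts through
  \<open>Acl\<close>, while the innovation of time \<open>Suc t\<close> enters only through
  \<open>cK\<close>. The sample point is fixed, since the theorem grants the law only on the sample
  space.\<close>

lemma aug_state_feedback:
  assumes fb: "\<And>t. t \<le> n \<Longrightarrow>
      a t \<omega> = cL S \<alpha> t *v aug_state S D a t \<omega> + cO S \<alpha> t *v att_innov S D a t \<omega>"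
    and "t \<le> n"
  shows "aug_state S D a t \<omega> = aug_pred S D \<alpha> t \<omega> + cK S *v innov S D t \<omega>"
  using \<open>t \<le> n\<close>
proof (induction t)
  case 0
  then show ?case by (simp add: aug_state_0 aug_pred.simps)
next
  case (Suc t)
  then have "aug_state S D a t \<omega> = aug_pred S D \<alpha> t \<omega> + cK S *v innov S D t \<omega>" by simp
  then show ?case
    using fb[of t] Suc.prems
    by (simp add: aug_state_Suc aug_pred.simps att_innov_eq Acl_def algebra_simps
        flip: matrix_vector_mul_assoc)
qed

lemma sys_innov_feedback:
  assumes fb: "\<And>t. t \<le> n \<Longrightarrow>
      a t \<omega> = cL S \<alpha> t *v aug_state S D a t \<omega> + cO S \<alpha> t *v att_innov S D a t \<omega>"
    and "t \<le> n"
  shows "sys_innov S D a t \<omega> = Ccl S \<alpha> t *v aug_pred S D \<alpha> t \<omega>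
     + (Ccl S \<alpha> t ** cK S + Dcl S \<alpha> t) *v innov S D t \<omega>"
  using fb[OF \<open>t \<le> n\<close>]
  by (simp add: sys_innov_aug_state aug_state_feedback[OF assms] att_innov_eq Ccl_def Dcl_def
      algebra_simps flip: matrix_vector_mul_assoc)

lemma plant_state_feedback:
  assumes "\<And>t. t \<le> n \<Longrightarrow>
      a t \<omega> = cL S \<alpha> t *v aug_state S D a t \<omega> + cO S \<alpha> t *v att_innov S D a t \<omega>"
    and "t \<le> n"
  shows "plant_state S D a t \<omega> - target S = filt_error S D t \<omega>
     + (cH S *v aug_pred S D \<alpha> t \<omega> + (cH S ** cK S) *v innov S D t \<omega>)"
  by (simp add: plant_state_aug_state aug_state_feedback[OF assms] algebra_simps
      flip: matrix_vector_mul_assoc)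

section \<open>The recursions as identities of functions, for rewriting inside
  \<open>second_moment\<close>\<close>

lemma pred_error_Suc_fun:
  "pred_error S D (Suc t) = (\<lambda>\<omega>. matA S *v filt_error S D t \<omega> + noiseW D (int t) \<omega>)"
  by (simp add: fun_eq_iff pred_error_Suc)

lemma pred_error_0_fun: "pred_error S D 0 = (\<lambda>\<omega>. preX D 0 \<omega> - prePred D 0 \<omega>)"
  by (simp add: fun_eq_iff pred_error.simps)

lemma innov_fun:
  "innov S D t = (\<lambda>\<omega>. matC S *v pred_error S D t \<omega> + noiseV D (int t) \<omega>)"
  by (simp add: fun_eq_iff innov_def)

lemma filt_error_fun:
  "filt_error S D t = (\<lambda>\<omega>. pred_error S D t \<omega> - matK S *v innov S D t \<omega>)"
  by (simp add: fun_eq_iff filt_error_def)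

text \<open>Writing the initial vector with a transposed block row gives its second moment the shape
  of \<open>\<Sigma>\<xi>0\<close>.\<close>

lemma aug_pred_0_fun:
  "aug_pred S D \<alpha> 0 = (\<lambda>\<omega>. transpose (mat 1 ||| 0 ||| mat 1 ||| 0) *v prePred D 0 \<omega>
     + (0 /// 0 /// 0 /// target S))"
  by (simp add: fun_eq_iff aug_pred.simps transpose_hcat vcat_mult_vec vcat_add
      del: transpose_matrix_vector)

lemma aug_pred_Suc_fun:
  "aug_pred S D \<alpha> (Suc t) = (\<lambda>\<omega>. Acl S \<alpha> t *v aug_pred S D \<alpha> t \<omega>
     + (Acl S \<alpha> t ** cK S + cB S ** cO S \<alpha> t) *v innov S D t \<omega>)"
  by (simp add: fun_eq_iff aug_pred.simps)

declare transpose_matrix_vector [simp del]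

section \<open>Second moments of the estimation errors\<close>

context attack_setting
begin

lemma noise_square_integrable: "square_integrable M (noiseW D t)" "square_integrable M (noiseV D t)"
  using w_gauss v_gauss gaussian_vector_square_integrable by blast+

lemma indep_rv_second_moment:
  fixes X :: "'w \<Rightarrow> real^'b" and Y :: "'w \<Rightarrow> real^'c"
  assumes ind: "indep_rv M N U N' V"
    and X: "X \<in> measurable (vimage_algebra (space M) U N) borel"
    and Y: "Y \<in> measurable (vimage_algebra (space M) V N') borel"
    and "square_integrable M X" "square_integrable M Y" "\<And>i. (\<integral>\<omega>. X \<omega> $ i \<partial>M) = 0"
  shows "second_moment M X Y = 0"
  by (rule indep_var_second_moment)
    (use assms measurable_compose[OF X borel_measurable_vec_nth]
      measurable_compose[OF Y borel_measurable_vec_nth] in \<open>auto intro: indep_rv_imp_indep_var[OF ind]\<close>)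

text \<open>Restricting the independent family of pairs to \<open>{s}\<close> and \<open>{t}\<close>
  and composing with coordinate functions gives scalar independence. \<open>f\<close> and
  \<open>g\<close> stay free so that one statement serves every choice of components.\<close>

lemma noise_pairs_second_moment:
  fixes f :: "(real^'n) \<times> (real^'p) \<Rightarrow> real^'b" and g :: "(real^'n) \<times> (real^'p) \<Rightarrow> real^'c"
  assumes "s \<noteq> t"
    and f: "f \<in> borel_measurable borel" and g: "g \<in> borel_measurable borel"
    and "square_integrable M (\<lambda>\<omega>. f (noiseW D s \<omega>, noiseV D s \<omega>))"
      "square_integrable M (\<lambda>\<omega>. g (noiseW D t \<omega>, noiseV D t \<omega>))"
      "\<And>i. (\<integral>\<omega>. f (noiseW D s \<omega>, noiseV D s \<omega>) $ i \<partial>M) = 0"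
  shows "second_moment M (\<lambda>\<omega>. f (noiseW D s \<omega>, noiseV D s \<omega>))
    (\<lambda>\<omega>. g (noiseW D t \<omega>, noiseV D t \<omega>)) = 0"
proof (rule indep_var_second_moment[OF _ assms(4-6)])
  fix i j
  let ?Z = "\<lambda>t \<omega>. (noiseW D t \<omega>, noiseV D t \<omega>)"
  have "(\<lambda>h. f (h s) $ i) \<in> borel_measurable (PiM {s} (\<lambda>_. borel))"
    by (intro measurable_compose[OF _ borel_measurable_vec_nth] measurable_compose[OF _ f]) simp
  moreover have "(\<lambda>h. g (h t) $ j) \<in> borel_measurable (PiM {t} (\<lambda>_. borel))"
    by (intro measurable_compose[OF _ borel_measurable_vec_nth] measurable_compose[OF _ g]) simp
  ultimately have "indep_var borel ((\<lambda>h. f (h s) $ i) \<circ> (\<lambda>\<omega>. restrict (\<lambda>i. ?Z i \<omega>) {s}))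
    borel ((\<lambda>h. g (h t) $ j) \<circ> (\<lambda>\<omega>. restrict (\<lambda>i. ?Z i \<omega>) {t}))"
    using assms(1) by (intro indep_var_compose[OF indep_var_restrict[OF pairs_indep]]) auto
  then show "indep_var borel (\<lambda>\<omega>. f (?Z s \<omega>) $ i) borel (\<lambda>\<omega>. g (?Z t \<omega>) $ j)"
    by (simp add: comp_def)
qed

lemma noise_second_moment:
  "second_moment M (noiseW D t) (noiseW D t) = \<Sigma>w S"
  "second_moment M (noiseV D t) (noiseV D t) = \<Sigma>v S"
  "second_moment M (noiseW D s) (noiseV D t) = 0"
  "s \<noteq> t \<Longrightarrow> second_moment M (noiseW D s) (noiseW D t) = 0"
  "s \<noteq> t \<Longrightarrow> second_moment M (noiseV D s) (noiseV D t) = 0"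
proof -
  note mean = gaussian_vector_expectation[OF w_gauss] gaussian_vector_expectation[OF v_gauss]
  have f [simp]: "(fst :: (real^'n) \<times> (real^'p) \<Rightarrow> _) \<in> borel_measurable borel"
    "(snd :: (real^'n) \<times> (real^'p) \<Rightarrow> _) \<in> borel_measurable borel"
    by (auto intro!: borel_measurable_continuous_onI continuous_intros)
  show "second_moment M (noiseW D t) (noiseW D t) = \<Sigma>w S"
    "second_moment M (noiseV D t) (noiseV D t) = \<Sigma>v S"
    by (rule gaussian_vector_second_moment[OF w_gauss] gaussian_vector_second_moment[OF v_gauss])+
  show "second_moment M (noiseW D s) (noiseV D t) = 0"
  \<comment> \<open>Equal times use independence within a pair, distinct times independence between
    pairs.\<close>
  proof (cases "s = t")
    case True
    show ?thesis unfolding True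
      by (rule indep_rv_second_moment[OF wv_indep]) (auto simp: noise_square_integrable mean
          intro: measurable_vimage_algebra1)
  next
    case False
    then show ?thesis
      using noise_pairs_second_moment[of s t fst snd] by (simp add: noise_square_integrable mean)
  qed
  assume "s \<noteq> t"
  then show "second_moment M (noiseW D s) (noiseW D t) = 0" "second_moment M (noiseV D s) (noiseV D t) = 0"
    using noise_pairs_second_moment[of s t fst fst] noise_pairs_second_moment[of s t snd snd]
    by (simp_all add: noise_square_integrable mean)
qed

lemma pred0_square_integrable: "square_integrable M (prePred D 0)"
  and pred0_second_moment: "second_moment M (prePred D 0) (prePred D 0) = \<Sigma>0 S"
  and pred_error_0_square_integrable: "square_integrable M (pred_error S D 0)"
  and pred_error_0_second_moment: "second_moment M (pred_error S D 0) (pred_error S D 0) = matP S"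
  using gaussian_vector_square_integrable[OF pred0_gauss] gaussian_vector_second_moment[OF pred0_gauss]
    gaussian_vector_square_integrable[OF err0_gauss] gaussian_vector_second_moment[OF err0_gauss]
  by (simp_all add: pred_error_0_fun)

lemma pred0_measurable_pre_outputs:
  "prePred D 0 \<in> borel_measurable (vimage_algebra (space M) (pre_outputs D) (borel_fam {..<0}))"
  using pred0_cond_mean by (simp add: cond_mean_def)

text \<open>The prediction is a version of a conditional mean, hence measurable in the pre-attack
  outputs, of which the initial error is independent.\<close>

lemma pred_error_0_pred0: "second_moment M (pred_error S D 0) (prePred D 0) = 0"
  unfolding pred_error_0_fun
  by (rule indep_rv_second_moment[OF err0_indep _ pred0_measurable_pre_outputs])
    (auto simp: pred_error_0_square_integrable[unfolded pred_error_0_fun] pred0_square_integrable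
      intro: measurable_vimage_algebra1 gaussian_vector_expectation[OF err0_gauss, simplified])

lemma pre_measurable:
  "preX D 0 \<in> borel_measurable (vimage_algebra (space M) (\<lambda>\<omega>. (preX D 0 \<omega>, pre_outputs D \<omega>))
     (borel \<Otimes>\<^sub>M borel_fam {..<0}))" (is "_ \<in> borel_measurable ?F")
  "prePred D 0 \<in> borel_measurable (vimage_algebra (space M) (\<lambda>\<omega>. (preX D 0 \<omega>, pre_outputs D \<omega>))
     (borel \<Otimes>\<^sub>M borel_fam {..<0}))"
proof -
  have "(\<lambda>\<omega>. (preX D 0 \<omega>, pre_outputs D \<omega>)) \<in> space M \<rightarrow> space (borel \<Otimes>\<^sub>M borel_fam {..<0})"
    by (auto simp: space_pair_measure space_PiM pre_outputs_def)
  then have *: "(\<lambda>\<omega>. (preX D 0 \<omega>, pre_outputs D \<omega>)) \<in> ?F \<rightarrow>\<^sub>M borel \<Otimes>\<^sub>M borel_fam {..<0}"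
    by (rule measurable_vimage_algebra1)
  show "preX D 0 \<in> borel_measurable ?F"
    using measurable_compose[OF * measurable_fst] by simp
  have "pre_outputs D \<in> ?F \<rightarrow>\<^sub>M borel_fam {..<0}"
    using measurable_compose[OF * measurable_snd] by simp
  \<comment> \<open>The algebra of the pair refines that of its second component, in which the
    prediction is measurable.\<close>
  then have "id \<in> ?F \<rightarrow>\<^sub>M vimage_algebra (space M) (pre_outputs D) (borel_fam {..<0})"
    by (intro measurable_vimage_algebra2) auto
  from measurable_comp[OF this pred0_measurable_pre_outputs]
  show "prePred D 0 \<in> borel_measurable ?F" by simp
qed

lemma noise_pre:
  assumes Y: "Y \<in> borel_measurable (vimage_algebra (space M) (\<lambda>\<omega>. (preX D 0 \<omega>, pre_outputs D \<omega>))
     (borel \<Otimes>\<^sub>M borel_fam {..<0}))" "square_integrable M Y"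
  shows "second_moment M (noiseW D (int t)) Y = 0" "second_moment M (noiseV D (int t)) Y = 0"
proof -
  let ?F = "vimage_algebra (space M) (future_noise D) (borel_fam {0..})"
  have "future_noise D \<in> space M \<rightarrow> space (borel_fam {0..})"
    by (auto simp: space_PiM future_noise_def)
  then have F: "future_noise D \<in> ?F \<rightarrow>\<^sub>M borel_fam {0..}"
    by (rule measurable_vimage_algebra1)
  have f: "(fst :: (real^'n) \<times> (real^'p) \<Rightarrow> _) \<in> borel_measurable borel"
    "(snd :: (real^'n) \<times> (real^'p) \<Rightarrow> _) \<in> borel_measurable borel"
    by (auto intro!: borel_measurable_continuous_onI continuous_intros)
  have c: "(\<lambda>h. h (int t)) \<in> borel_fam {0..} \<rightarrow>\<^sub>M borel" by simp
  have W: "noiseW D (int t) \<in> borel_measurable ?F" "noiseV D (int t) \<in> borel_measurable ?F"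
    using measurable_compose[OF measurable_compose[OF F c] f(1)]
      measurable_compose[OF measurable_compose[OF F c] f(2)] by (simp_all add: future_noise_def)
  show "second_moment M (noiseW D (int t)) Y = 0" "second_moment M (noiseV D (int t)) Y = 0"
    by (rule indep_rv_second_moment[OF future_indep W(1) Y(1)]
        indep_rv_second_moment[OF future_indep W(2) Y(1)],
        auto simp: noise_square_integrable Y(2) gaussian_vector_expectation[OF w_gauss]
          gaussian_vector_expectation[OF v_gauss])+
qed

lemma noise_pred0:
  "second_moment M (noiseW D (int t)) (prePred D 0) = 0"
  "second_moment M (noiseV D (int t)) (prePred D 0) = 0"
  by (rule noise_pre[OF pre_measurable(2) pred0_square_integrable])+

lemma noise_pred_error_0:
  "second_moment M (noiseW D (int t)) (pred_error S D 0) = 0"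
  "second_moment M (noiseV D (int t)) (pred_error S D 0) = 0"
proof -
  have "pred_error S D 0 \<in> borel_measurable (vimage_algebra (space M)
     (\<lambda>\<omega>. (preX D 0 \<omega>, pre_outputs D \<omega>)) (borel \<Otimes>\<^sub>M borel_fam {..<0}))"
    using borel_measurable_diff[OF pre_measurable] by (simp add: pred_error_0_fun)
  then show "second_moment M (noiseW D (int t)) (pred_error S D 0) = 0"
    "second_moment M (noiseV D (int t)) (pred_error S D 0) = 0"
    by (rule noise_pre[OF _ pred_error_0_square_integrable])+
qed

lemma pred_error_square_integrable: "square_integrable M (pred_error S D t)"
proof (induction t)
  case 0
  then show ?case by (rule pred_error_0_square_integrable)
next
  case (Suc t)
  then show ?case
    by (simp add: pred_error_Suc_fun filt_error_fun innov_fun square_integrable_intros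
        noise_square_integrable)
qed

lemma innov_square_integrable: "square_integrable M (innov S D t)"
  by (simp add: innov_fun square_integrable_intros noise_square_integrable pred_error_square_integrable)

lemma filt_error_square_integrable: "square_integrable M (filt_error S D t)"
  by (simp add: filt_error_fun square_integrable_intros innov_square_integrable
      pred_error_square_integrable)

lemma aug_pred_square_integrable: "square_integrable M (aug_pred S D \<alpha> t)"
proof (induction t)
  case 0
  show ?case
    by (simp add: aug_pred_0_fun square_integrable_intros pred0_square_integrable square_integrable_const)
next
  case (Suc t)
  then show ?case by (simp add: aug_pred_Suc_fun square_integrable_intros innov_square_integrable)
qed

lemmas square_integrable_rules =
  square_integrable_intros square_integrable_const noise_square_integrable pred0_square_integrable
  pred_error_square_integrable innov_square_integrable filt_error_square_integrable
  aug_pred_square_integrable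

lemma noise_const:
  "second_moment M (noiseW D t) (\<lambda>_. c) = 0" "second_moment M (noiseV D t) (\<lambda>_. c) = 0"
  by (rule second_moment_const_right gaussian_vector_expectation[OF w_gauss]
      gaussian_vector_expectation[OF v_gauss])+

text \<open>Causality: the error at time \<open>t\<close> is built from the initial data and noises
  strictly before \<open>t\<close>, so the case \<open>t = s\<close> is included.\<close>

lemma noise_pred_error:
  "t \<le> s \<Longrightarrow> second_moment M (noiseW D (int s)) (pred_error S D t) = 0
    \<and> second_moment M (noiseV D (int s)) (pred_error S D t) = 0"
proof (induction t)
  case 0
  then show ?case by (simp add: noise_pred_error_0)
next
  case (Suc t)
  then show ?case
    by (simp add: pred_error_Suc_fun filt_error_fun innov_fun second_moment_linear
        square_integrable_rules noise_second_moment noise_second_moment(3)[THEN second_moment_zero_swap])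
qed

text \<open>Strict inequality here, because the innovation at \<open>t\<close> contains the
  measurement noise of time \<open>t\<close>.\<close>

lemma noise_innov:
  assumes "t < s"
  shows "second_moment M (noiseW D (int s)) (innov S D t) = 0"
    "second_moment M (noiseV D (int s)) (innov S D t) = 0"
  using assms noise_pred_error[of t s]
  by (simp_all add: innov_fun second_moment_linear square_integrable_rules noise_second_moment
      noise_second_moment(3)[THEN second_moment_zero_swap])

lemma noise_aug_pred:
  "t \<le> s \<Longrightarrow> second_moment M (noiseW D (int s)) (aug_pred S D \<alpha> t) = 0
    \<and> second_moment M (noiseV D (int s)) (aug_pred S D \<alpha> t) = 0"
proof (induction t)
  case 0
  then show ?case
    by (simp add: aug_pred_0_fun second_moment_linear square_integrable_rules noise_const noise_pred0)
next
  case (Suc t)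
  then show ?case
    by (simp add: aug_pred_Suc_fun second_moment_linear square_integrable_rules noise_innov)
qed

section \<open>The steady state of the Kalman filter\<close>

lemma \<Sigma>\<nu>_symmetric: "transpose (\<Sigma>\<nu> S) = \<Sigma>\<nu> S"
  using valid by (simp add: valid_plant_def sym_psd_def sym_pd_def \<Sigma>\<nu>_def transpose_add
      matrix_transpose_mul matrix_mul_assoc)

text \<open>Adding the definite \<open>\<Sigma>v S\<close> to a semidefinite matrix makes
  \<open>\<Sigma>\<nu> S\<close> definite, so its inverse inside the gain cancels.\<close>

lemma gain_mult_\<Sigma>\<nu>: "matK S ** \<Sigma>\<nu> S = matP S ** transpose (matC S)"
proof -
  have pos: "0 < z \<bullet> (\<Sigma>\<nu> S *v z)" if "z \<noteq> 0" for z
  proof -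
    have "z \<bullet> (\<Sigma>\<nu> S *v z) = (transpose (matC S) *v z) \<bullet> (matP S *v (transpose (matC S) *v z))
        + z \<bullet> (\<Sigma>v S *v z)"
      by (simp add: \<Sigma>\<nu>_def matrix_vector_mult_add_rdistrib inner_add_right transpose_matrix_vector
          dot_lmul_matrix flip: matrix_vector_mul_assoc)
    moreover have "0 < z \<bullet> (\<Sigma>v S *v z)"
      "0 \<le> (transpose (matC S) *v z) \<bullet> (matP S *v (transpose (matC S) *v z))"
      using valid that by (auto simp: valid_plant_def sym_psd_def sym_pd_def)
    ultimately show ?thesis by simp
  qed
  then have "invertible (\<Sigma>\<nu> S)"
    by (intro sym_pd_invertible) (simp add: sym_pd_def \<Sigma>\<nu>_symmetric)
  then show ?thesis
    by (simp add: matK_def matrix_inv_mult_cancel flip: matrix_mul_assoc)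
qed

text \<open>The assumed Riccati equation, regrouped as the time update of the posterior
  covariance.\<close>

lemma riccati: "matP S = matA S ** Phat S ** transpose (matA S) + \<Sigma>w S"
proof -
  have "matP S = matA S ** matP S ** transpose (matA S) + \<Sigma>w S
       - matA S ** matP S ** transpose (matC S) ** matrix_inv (\<Sigma>\<nu> S)
         ** matC S ** matP S ** transpose (matA S)"
    using valid unfolding valid_plant_def \<Sigma>\<nu>_def by blast
  then show ?thesis
    by (simp add: Phat_def matrix_mult_diff_left matrix_mult_diff_right matrix_mul_assoc diff_add_eq)
qed

text \<open>The gain is chosen so that the filtering error is orthogonal to the innovation: their
  second moment is the difference of the two sides of
  \<open>gain_mult_\<Sigma>\<nu>\<close>.\<close>

lemma kalman_step:
  assumes P: "second_moment M (pred_error S D t) (pred_error S D t) = matP S"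
  shows "second_moment M (innov S D t) (innov S D t) = \<Sigma>\<nu> S"
    "second_moment M (filt_error S D t) (innov S D t) = 0"
    "second_moment M (filt_error S D t) (filt_error S D t) = Phat S"
proof -
  have vp: "second_moment M (noiseV D (int t)) (pred_error S D t) = 0"
    using noise_pred_error by simp
  note rules = second_moment_linear square_integrable_rules P vp second_moment_zero_swap[OF vp]
    noise_second_moment
  show i: "second_moment M (innov S D t) (innov S D t) = \<Sigma>\<nu> S"
    by (simp add: innov_fun rules \<Sigma>\<nu>_def matrix_mul_assoc)
  have pi: "second_moment M (pred_error S D t) (innov S D t) = matP S ** transpose (matC S)"
    and ip: "second_moment M (innov S D t) (pred_error S D t) = matC S ** matP S"
    by (simp_all add: innov_fun rules)
  show fi: "second_moment M (filt_error S D t) (innov S D t) = 0"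
    by (simp add: filt_error_fun rules i pi gain_mult_\<Sigma>\<nu>)
  \<comment> \<open>By this orthogonality the gain correction drops out of the right factor.\<close>
  have "second_moment M (filt_error S D t) (filt_error S D t)
      = second_moment M (filt_error S D t) (pred_error S D t)"
    by (subst (2) filt_error_fun) (simp add: rules fi)
  also have "\<dots> = Phat S"
    by (simp add: filt_error_fun rules ip Phat_def matK_def matrix_mul_assoc)
  finally show "second_moment M (filt_error S D t) (filt_error S D t) = Phat S" .
qed

text \<open>Stationarity: the measurement update takes \<open>matP S\<close> to
  \<open>Phat S\<close>, and the time update brings it back by \<open>riccati\<close>.\<close>

lemma pred_error_second_moment: "second_moment M (pred_error S D t) (pred_error S D t) = matP S"
proof (induction t)
  case 0
  then show ?case by (rule pred_error_0_second_moment)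
next
  case (Suc t)
  have "second_moment M (noiseW D (int t)) (filt_error S D t) = 0"
    using noise_pred_error[of t t]
    by (simp add: filt_error_fun innov_fun second_moment_linear square_integrable_rules
        noise_second_moment)
  then show ?case
    using second_moment_zero_swap[of M "noiseW D (int t)" "filt_error S D t"]
    by (simp add: pred_error_Suc_fun second_moment_linear square_integrable_rules
        noise_second_moment kalman_step[OF Suc] riccati[symmetric] matrix_mul_assoc)
qed

lemmas innov_second_moment = kalman_step(1)[OF pred_error_second_moment]
  and filt_error_innov = kalman_step(2)[OF pred_error_second_moment]
  and filt_error_second_moment = kalman_step(3)[OF pred_error_second_moment]

text \<open>The new prediction error combines the old filtering error with process noise, and
  \<open>aug_pred\<close> combines its old value with the old innovation; all four cross terms
  vanish. The three claims are proved together because the step needs the filtering error, whose own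
  claim follows from the prediction error of the same time.\<close>

lemma pred_error_aug_pred:
  "second_moment M (pred_error S D t) (aug_pred S D \<alpha> t) = 0
   \<and> second_moment M (innov S D t) (aug_pred S D \<alpha> t) = 0
   \<and> second_moment M (filt_error S D t) (aug_pred S D \<alpha> t) = 0"
proof (induction t)
  case 0
  have "second_moment M (pred_error S D 0) (\<lambda>_. c) = 0" for c :: "real^'n blk6"
    unfolding pred_error_0_fun
    by (rule second_moment_const_right[OF gaussian_vector_expectation[OF err0_gauss]])
  then have "second_moment M (pred_error S D 0) (aug_pred S D \<alpha> 0) = 0"
    by (simp add: aug_pred_0_fun second_moment_linear square_integrable_rules pred_error_0_pred0)
  then show ?case
    using noise_aug_pred[of 0 0 \<alpha>]
    by (simp add: filt_error_fun innov_fun second_moment_linear square_integrable_rules)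
next
  case (Suc t)
  \<comment> \<open>Equal times lie outside \<open>noise_innov\<close>, but the innovation contains
    only the measurement noise of its own time, not the process noise.\<close>
  have "second_moment M (noiseW D (int t)) (innov S D t) = 0"
    using noise_pred_error[of t t]
    by (simp add: innov_fun second_moment_linear square_integrable_rules noise_second_moment)
  then have "second_moment M (pred_error S D (Suc t)) (aug_pred S D \<alpha> (Suc t)) = 0"
    using Suc noise_aug_pred[of t t \<alpha>]
    by (simp add: pred_error_Suc_fun aug_pred_Suc_fun second_moment_linear square_integrable_rules
        filt_error_innov)
  then show ?case
    using noise_aug_pred[of "Suc t" "Suc t" \<alpha>]
    by (simp add: filt_error_fun innov_fun second_moment_linear square_integrable_rules)
qed

text \<open>The initial prediction has mean zero, so the mixed terms with the constant target block
  vanish.\<close>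

lemma aug_pred_second_moment_0: "second_moment M (aug_pred S D \<alpha> 0) (aug_pred S D \<alpha> 0) = \<Sigma>\<xi>0 S"
proof -
  have p: "second_moment M (prePred D 0) (\<lambda>_. c) = 0" for c :: "real^'n blk6"
    by (rule second_moment_const_right[OF gaussian_vector_expectation[OF pred0_gauss]])
  have c: "second_moment M (\<lambda>_. c) (\<lambda>_. c) = (\<chi> i j. c $ i * c $ j)" for c :: "real^'n blk6"
    by (simp add: second_moment_def prob_space)
  show ?thesis
    by (simp add: aug_pred_0_fun second_moment_linear square_integrable_rules pred0_second_moment p
        p[THEN second_moment_zero_swap] c \<Sigma>\<xi>0_def Let_def matrix_mul_assoc)
qed

lemma aug_pred_second_moment_Suc:
  "second_moment M (aug_pred S D \<alpha> (Suc t)) (aug_pred S D \<alpha> (Suc t)) =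
     Acl S \<alpha> t ** second_moment M (aug_pred S D \<alpha> t) (aug_pred S D \<alpha> t) ** transpose (Acl S \<alpha> t)
     + (Acl S \<alpha> t ** cK S + cB S ** cO S \<alpha> t) ** \<Sigma>\<nu> S
        ** transpose (Acl S \<alpha> t ** cK S + cB S ** cO S \<alpha> t)"
  using pred_error_aug_pred[of t \<alpha>] second_moment_zero_swap[of M "innov S D t" "aug_pred S D \<alpha> t"]
  by (simp add: aug_pred_Suc_fun second_moment_linear square_integrable_rules innov_second_moment
      matrix_mul_assoc)

lemma feedback_output_second_moment:
  "second_moment M (\<lambda>\<omega>. Y *v aug_pred S D \<alpha> t \<omega> + Z *v innov S D t \<omega>)
       (\<lambda>\<omega>. Y *v aug_pred S D \<alpha> t \<omega> + Z *v innov S D t \<omega>) =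
     Y ** second_moment M (aug_pred S D \<alpha> t) (aug_pred S D \<alpha> t) ** transpose Y
     + Z ** \<Sigma>\<nu> S ** transpose Z"
  using pred_error_aug_pred[of t \<alpha>] second_moment_zero_swap[of M "innov S D t" "aug_pred S D \<alpha> t"]
  by (simp add: second_moment_linear square_integrable_rules innov_second_moment matrix_mul_assoc)

lemma filt_error_feedback_output_second_moment:
  "second_moment M (\<lambda>\<omega>. filt_error S D t \<omega> + (Y *v aug_pred S D \<alpha> t \<omega> + Z *v innov S D t \<omega>))
       (\<lambda>\<omega>. filt_error S D t \<omega> + (Y *v aug_pred S D \<alpha> t \<omega> + Z *v innov S D t \<omega>)) =
     Phat S + (Y ** second_moment M (aug_pred S D \<alpha> t) (aug_pred S D \<alpha> t) ** transpose Y
     + Z ** \<Sigma>\<nu> S ** transpose Z)"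
proof -
  let ?y = "\<lambda>\<omega>. Y *v aug_pred S D \<alpha> t \<omega> + Z *v innov S D t \<omega>"
  have y: "square_integrable M ?y" by (simp add: square_integrable_rules)
  have "second_moment M (filt_error S D t) ?y = 0"
    using pred_error_aug_pred[of t \<alpha>]
    by (simp add: second_moment_linear square_integrable_rules filt_error_innov)
  with second_moment_zero_swap[OF this] show ?thesis
    by (simp only: second_moment_add_left[OF filt_error_square_integrable y]
        second_moment_add_right[OF filt_error_square_integrable y] square_integrable_add
        filt_error_square_integrable y filt_error_second_moment feedback_output_second_moment
        add_0_left add_0_right)
qed

end

section \<open>Symmetry of the backward recursions and summation of the stage costs\<close>

lemma Qtil_symmetric:
  assumes "\<forall>t\<le>horizon S. transpose (matR S t) = matR S t"
  shows "transpose (Qtil S \<alpha> t) = Qtil S \<alpha> t"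
  using assms
  by (induction S \<alpha> t rule: Qtil.induct)
    (subst (1 2) Qtil.simps, auto simp: transpose_add matrix_transpose_mul matrix_mul_assoc)

lemma Qbar_symmetric:
  assumes "\<forall>t\<le>horizon S. transpose (matQ S t) = matQ S t"
  shows "transpose (Qbar S \<alpha> t) = Qbar S \<alpha> t"
  using assms
  by (induction S \<alpha> t rule: Qbar.induct)
    (subst (1 2) Qbar.simps, auto simp: transpose_add matrix_transpose_mul matrix_mul_assoc)

context attack_setting
begin

lemma weights_symmetric:
  "t \<le> horizon S \<Longrightarrow> transpose (matQ S t) = matQ S t"
  "t \<le> horizon S \<Longrightarrow> transpose (matR S t) = matR S t"
  using valid by (auto simp: valid_plant_def sym_pd_def)

abbreviation "aug_cov \<alpha> t \<equiv> second_moment M (aug_pred S D \<alpha> t) (aug_pred S D \<alpha> t)"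

text \<open>Common form of both costs: \<open>C\<close>, \<open>E\<close>, \<open>W\<close> become
  \<open>Ccl\<close>, \<open>Dcl\<close>, \<open>matR\<close> for detection and \<open>cH\<close>,
  0, \<open>matQ\<close> for control. \<open>trace_cost_to_go\<close> sums the state part, and
  \<open>feedback_noise_cost\<close> merges the two innovation terms of each time.\<close>

lemma feedback_cost_sum:
  fixes Q :: "nat \<Rightarrow> real^'n blk6^'n blk6" and C :: "nat \<Rightarrow> real^'n blk6^'c"
  assumes Q: "\<And>t. t \<le> N \<Longrightarrow> Q t = transpose (Acl S \<alpha> t) ** Q (Suc t) ** Acl S \<alpha> t
        + transpose (C t) ** W t ** C t"
    and "Q (Suc N) = 0" "\<And>t. transpose (Q t) = Q t" "\<And>t. t \<le> N \<Longrightarrow> transpose (W t) = W t"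
  shows "(\<Sum>t\<le>N. trace ((C t ** aug_cov \<alpha> t ** transpose (C t)
        + (C t ** cK S + E t) ** \<Sigma>\<nu> S ** transpose (C t ** cK S + E t)) ** W t))
    = trace (\<Sigma>\<xi>0 S ** Q 0) + (\<Sum>t\<le>N. trace (\<Sigma>\<nu> S ** (transpose (cK S) ** Q t ** cK S
        + 2 *\<^sub>R (transpose (cK S) ** (transpose (Acl S \<alpha> t) ** Q (Suc t) ** (cB S ** cO S \<alpha> t)
            + transpose (C t) ** W t ** E t))
        + (transpose (cB S ** cO S \<alpha> t) ** Q (Suc t) ** (cB S ** cO S \<alpha> t)
            + transpose (E t) ** W t ** E t))))"
proof -
  let ?G = "\<lambda>t. Acl S \<alpha> t ** cK S + cB S ** cO S \<alpha> t"
  have split: "(\<Sum>t\<le>N. trace ((C t ** aug_cov \<alpha> t ** transpose (C t)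
        + (C t ** cK S + E t) ** \<Sigma>\<nu> S ** transpose (C t ** cK S + E t)) ** W t))
      = (\<Sum>t\<le>N. trace (aug_cov \<alpha> t ** (transpose (C t) ** W t ** C t)))
        + (\<Sum>t\<le>N. trace (\<Sigma>\<nu> S ** (transpose (C t ** cK S + E t) ** W t ** (C t ** cK S + E t))))"
    by (simp only: matrix_mult_add_left[of _ _ "W _"] trace_add trace_conjugate sum.distrib)
  \<comment> \<open>Summing up to \<open>Suc N\<close> leaves no terminal trace, since
    \<open>Q (Suc N) = 0\<close>.\<close>
  have state: "(\<Sum>t\<le>N. trace (aug_cov \<alpha> t ** (transpose (C t) ** W t ** C t)))
      = trace (\<Sigma>\<xi>0 S ** Q 0) + (\<Sum>t\<le>N. trace (\<Sigma>\<nu> S ** (transpose (?G t) ** Q (Suc t) ** ?G t)))"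
    using trace_cost_to_go[of "aug_cov \<alpha>" "Acl S \<alpha>" ?G "\<Sigma>\<nu> S" "Suc N" Q
        "\<lambda>t. transpose (C t) ** W t ** C t", OF aug_pred_second_moment_Suc] Q assms(2)
    by (simp add: lessThan_Suc_atMost less_Suc_eq_le aug_pred_second_moment_0 trace_0[simplified])
  have noise: "(\<Sum>t\<le>N. trace (\<Sigma>\<nu> S ** (transpose (?G t) ** Q (Suc t) ** ?G t)))
      + (\<Sum>t\<le>N. trace (\<Sigma>\<nu> S ** (transpose (C t ** cK S + E t) ** W t ** (C t ** cK S + E t))))
    = (\<Sum>t\<le>N. trace (\<Sigma>\<nu> S ** (transpose (cK S) ** Q t ** cK S
        + 2 *\<^sub>R (transpose (cK S) ** (transpose (Acl S \<alpha> t) ** Q (Suc t) ** (cB S ** cO S \<alpha> t)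
            + transpose (C t) ** W t ** E t))
        + (transpose (cB S ** cO S \<alpha> t) ** Q (Suc t) ** (cB S ** cO S \<alpha> t)
            + transpose (E t) ** W t ** E t))))"
    unfolding sum.distrib[symmetric]
    by (intro sum.cong refl feedback_noise_cost assms \<Sigma>\<nu>_symmetric) simp_all
  show ?thesis
    unfolding split state add.assoc[of "trace (\<Sigma>\<xi>0 S ** Q 0)"] noise ..
qed

end

theorem theorem2:
  fixes M :: "'w measure"
    and S :: "('n::finite, 'm::finite, 's::finite, 'p::finite) plant"
    and D :: "('w, 'n, 'p) scenario"
    and \<alpha> :: real
    and e :: "('w, 's) attack"
  assumes setting: "attack_setting M S D"
    and alpha_pos: "\<alpha> > 0"
    and e_optimal: "optimal_attack M S D \<alpha> e"
    and e_feedback: "\<And>t \<omega>. t \<le> horizon S \<Longrightarrow> \<omega> \<in> space M \<Longrightarrow>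
          e t \<omega> = cL S \<alpha> t *v aug_state S D e t \<omega> + cO S \<alpha> t *v att_innov S D e t \<omega>"
  shows "integrable M (detect_cost S D e)
       \<and> J_d M S D e = trace (\<Sigma>\<xi>0 S ** Qtil S \<alpha> 0)
           + (\<Sum>t\<le>horizon S. trace (\<Sigma>\<nu> S **
               (transpose (cK S) ** Qtil S \<alpha> t ** cK S
                + 2 *\<^sub>R (transpose (cK S) ** Rtil S \<alpha> t) + Stil S \<alpha> t)))
       \<and> integrable M (control_cost S D e)
       \<and> J_c M S D e = trace (\<Sigma>\<xi>0 S ** Qbar S \<alpha> 0)
           + (\<Sum>t\<le>horizon S. trace (Phat S ** matQ S t) + trace (\<Sigma>\<nu> S **
               (transpose (cK S) ** Qbar S \<alpha> t ** cK S
                + 2 *\<^sub>R (transpose (cK S) ** Rbar S \<alpha> t) + Sbar S \<alpha> t)))"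
proof -
  interpret attack_setting M S D by (rule setting)
  let ?\<zeta> = "aug_pred S D \<alpha>" and ?N = "horizon S"
  \<comment> \<open>Under the feedback law \<open>y\<close> is the system's innovation and
    \<open>x\<close> the deviation from the target.\<close>
  define y where "y = (\<lambda>t \<omega>. Ccl S \<alpha> t *v ?\<zeta> t \<omega> + (Ccl S \<alpha> t ** cK S + Dcl S \<alpha> t) *v innov S D t \<omega>)"
  define x where "x = (\<lambda>t \<omega>. filt_error S D t \<omega> + (cH S *v ?\<zeta> t \<omega> + (cH S ** cK S) *v innov S D t \<omega>))"
  have sq: "square_integrable M (y t)" "square_integrable M (x t)" for t
    by (simp_all add: y_def x_def square_integrable_rules)
  \<comment> \<open>The feedback law is granted only on \<open>space M\<close>, so these identities
    enter the integrals by congruence on that set.\<close>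
  have d: "detect_cost S D e \<omega> = (\<Sum>t\<le>?N. y t \<omega> \<bullet> (matR S t *v y t \<omega>))"
    and c: "control_cost S D e \<omega> = (\<Sum>t\<le>?N. x t \<omega> \<bullet> (matQ S t *v x t \<omega>))"
    if "\<omega> \<in> space M" for \<omega>
    using sys_innov_feedback[of ?N e \<omega> S \<alpha> D] plant_state_feedback[of ?N e \<omega> S \<alpha> D]
      e_feedback[OF _ that]
    by (simp_all add: detect_cost_def control_cost_def y_def x_def)
  have integrable: "integrable M (detect_cost S D e)" "integrable M (control_cost S D e)"
    by (simp_all add: d c integrable_quadratic_form sq cong: Bochner_Integration.integrable_cong)

  have "J_d M S D e = (\<Sum>t\<le>?N. trace (second_moment M (y t) (y t) ** matR S t))"
    by (simp add: J_d_def d integral_quadratic_form integrable_quadratic_form sq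
        cong: Bochner_Integration.integral_cong)
  also have "\<dots> = trace (\<Sigma>\<xi>0 S ** Qtil S \<alpha> 0)
           + (\<Sum>t\<le>?N. trace (\<Sigma>\<nu> S **
               (transpose (cK S) ** Qtil S \<alpha> t ** cK S
                + 2 *\<^sub>R (transpose (cK S) ** Rtil S \<alpha> t) + Stil S \<alpha> t)))"
    using feedback_cost_sum[of ?N "Qtil S \<alpha>" \<alpha> "Ccl S \<alpha>" "matR S" "Dcl S \<alpha>"]
      Qtil.simps[of S \<alpha>] Qtil_symmetric[of S \<alpha>] weights_symmetric
    by (simp add: y_def feedback_output_second_moment Rtil_def Stil_def matrix_transpose_mul
        matrix_mul_assoc add.assoc)
  finally have J_d: "J_d M S D e = trace (\<Sigma>\<xi>0 S ** Qtil S \<alpha> 0)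
           + (\<Sum>t\<le>?N. trace (\<Sigma>\<nu> S **
               (transpose (cK S) ** Qtil S \<alpha> t ** cK S
                + 2 *\<^sub>R (transpose (cK S) ** Rtil S \<alpha> t) + Stil S \<alpha> t)))" .

  have "J_c M S D e = (\<Sum>t\<le>?N. trace (second_moment M (x t) (x t) ** matQ S t))"
    by (simp add: J_c_def c integral_quadratic_form integrable_quadratic_form sq
        cong: Bochner_Integration.integral_cong)
  also have "\<dots> = (\<Sum>t\<le>?N. trace (Phat S ** matQ S t))
      + (\<Sum>t\<le>?N. trace ((cH S ** aug_cov \<alpha> t ** transpose (cH S)
        + (cH S ** cK S) ** \<Sigma>\<nu> S ** transpose (cH S ** cK S)) ** matQ S t))"
    by (simp only: x_def filt_error_feedback_output_second_moment sum.distrib trace_add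
        matrix_mult_add_left[of "Phat S"])
  also have "\<dots> = trace (\<Sigma>\<xi>0 S ** Qbar S \<alpha> 0)
           + (\<Sum>t\<le>?N. trace (Phat S ** matQ S t) + trace (\<Sigma>\<nu> S **
               (transpose (cK S) ** Qbar S \<alpha> t ** cK S
                + 2 *\<^sub>R (transpose (cK S) ** Rbar S \<alpha> t) + Sbar S \<alpha> t)))"
    \<comment> \<open>The deviation from the target sees the innovation only through the augmented
      state, hence the zero for \<open>E\<close>.\<close>
    using feedback_cost_sum[of ?N "Qbar S \<alpha>" \<alpha> "\<lambda>_. cH S" "matQ S" "\<lambda>_. 0"]
      Qbar.simps[of S \<alpha>] Qbar_symmetric[of S \<alpha>] weights_symmetric
    by (simp add: Rbar_def Sbar_def matrix_transpose_mul matrix_mul_assoc sum.distrib)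
  finally show ?thesis
    using integrable J_d by blast
qed

end
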